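(* Let $\alpha_1,\dots,\alpha_6$ be an orthogonal basis of $\mathbb{R}^6$ consisting of vectors of norm $3$ (i.e. $(\alpha_i,\alpha_i)=3$), and let $L$ be the lattice spanned by the $\alpha_i$ together with $h:=\frac13(\alpha_1+\cdots+\alpha_6)$. Then $V_L$ contains an $N=4$ superconformal subalgebra $A$ such that the Virasoro vector of $A$ is the standard lattice Virasoro vector of central charge $c=6$.
   Context: **Lattice SVOA.** For a positive-definite integral lattice $L$, $V_L=M(1)\otimes\mathbb{C}^\varepsilon[L]$ is the standard lattice super vertex operator algebra, where $M(1)$ is the Heisenberg Fock space on $\mathfrak h=\mathbb{C}\otimes_{\mathbb Z}L$, and $\mathbb{C}^\varepsilon[L]$ has basis $e^\alpha$ ($\alpha\in L$) with $e^\alpha e^\beta=\varepsilon(\alpha,\beta)e^{\alpha+\beta}$; here $\varepsilon:L\times L\to\{\pm1\}$ is bimultiplicative with $\varepsilon(\alpha,\beta)\varepsilon(\beta,\alpha)=(-1)^{(\alpha,\beta)+(\alpha,\alpha)(\beta,\beta)}$ and $\varepsilon(\alpha,\alpha)=(-1)^{((\alpha,\alpha)+(\alpha,\alpha)^2)/2}$. The weight of $e^\alpha$ is $\frac12(\alpha,\alpha)$; parity of a weight-$k$ state is $2k\bmod 2$. The standard lattice Virasoro vector is $\frac12\sum_ih_i(-1)h_i$ for any orthonormal basis $\{h_i\}$ of $\mathfrak h$, where $h_i$ is identified with $h_i(-1)\mathbf 1$. Write $Y(u,z)=\sum_n u(n)z^{-n-1}$ and $Tu=u(-2)\mathbf 1$.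 **The $N=4$ algebra.** An $N=4$ superconformal subalgebra with central charge $c$ and Virasoro vector $\omega$ is a subalgebra generated (by iterated mode products applied to $\mathbf 1$) by four states $G^\pm,\overline G^\pm$ of weight $\frac32$ for which there are weight-one states $J^\pm,J^0$ in it, and $\omega$ is a Virasoro element of central charge $c$, satisfying (a) $J^0(0)J^\pm=\pm2J^\pm$; (b) $J^0(1)J^0=\frac c3\mathbf 1$; (c) $J^+(0)J^-=J^0$; (d) $J^+(1)J^-=\frac c6\mathbf 1$; (e) $J^0(0)G^\pm=\pm G^\pm$; (f) $J^0(0)\overline G^\pm=\pm\overline G^\pm$; (g) $J^\pm(0)G^\mp=G^\pm$; (h) $J^\pm(0)\overline G^\mp=-\overline G^\pm$; (i) $G^\pm(1)\overline G^\pm=2J^\pm$; (j) $G^\pm(1)\overline G^\mp=\pm J^0$; (k) $G^\pm(2)\overline G^\mp=\frac c3\mathbf 1$; (l) $G^\pm(0)\overline G^\pm=TJ^\pm$; (m) $G^\pm(0)\overline G^\mp=\omega\pm\frac12TJ^0$; together with the usual Virasoro relations ($J^\pm,J^0$ are primary of weight $1$ and $G^\pm,\overline G^\pm$ primary of weight $\frac32$ with respect to $\omega$), and all products $u(n)v$, $n\ge0$, of the states $G^\pm,\overline G^\pm,J^\pm,J^0,\omega$ not determined by the relations (a)–(m) and these Virasoro relations (directly or via super skew-symmetry) are zero; in particular $G(n)G=\overline G(n)\overline G=0$ for all $n\ge 0$, $J^\pm(0)G^\pm=J^\pm(0)\overline G^\pm=0$, $J(n)G=J(n)\overline G=0$ for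 $n\ge1$, and $G^\pm(2)\overline G^\pm=0$. *)

theory Defs
  imports "HOL-Analysis.Analysis" "HOL-Library.Poly_Mapping" "HOL-Library.Multiset"
    "HOL-Library.Groups_Big_Fun" "HOL-Library.Numeral_Type"
begin

text \<open>
  The lattice L is a subset of the Euclidean space \<open>real^'n\<close> that spans it, so the
  Heisenberg space is \<open>complex^'n\<close> with the orthonormal basis \<open>h_i = axis i 1\<close>.

  \<open>M(1) \<otimes> C[L]\<close> has the basis \<open>(\<Prod>_{(i,k) \<in># m} h_i(-k-1)) \<otimes> e^\<beta>\<close>, encoded as
  the pair \<open>(m, \<beta>)\<close>: the variable \<open>(i, k)\<close> with \<open>k \<ge> 0\<close> stands for the creation operator
  \<open>h_i(-k-1)\<close>, so that every multiset is a legitimate monomial of M(1).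
  States are finitely supported functions on this basis.  The type allows all \<open>\<beta> \<in> real^'n\<close>;
  the space \<open>V_L\<close> itself is \<open>lattice_sva L\<close> below.
\<close>

type_synonym 'n monom = "('n \<times> nat) multiset"
type_synonym 'n state = "('n monom \<times> (real^'n)) \<Rightarrow>\<^sub>0 complex"

definition scale :: "complex \<Rightarrow> ('b \<Rightarrow>\<^sub>0 complex) \<Rightarrow> ('b \<Rightarrow>\<^sub>0 complex)"  (infixr \<open>*\<^sub>C\<close> 75)
  where "c *\<^sub>C v = Poly_Mapping.map (\<lambda>x. c * x) v"

definition bstate :: "'n monom \<Rightarrow> real^'n \<Rightarrow> ('n::finite) state"
  where "bstate m \<beta> = Poly_Mapping.single (m, \<beta>) 1"

definition vac :: "('n::finite) state"
  where "vac = bstate {#} 0"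

definition lin_ext :: "('b \<Rightarrow> ('d \<Rightarrow>\<^sub>0 complex)) \<Rightarrow> ('b \<Rightarrow>\<^sub>0 complex) \<Rightarrow> ('d \<Rightarrow>\<^sub>0 complex)"
  where "lin_ext f v = (\<Sum>x\<in>Poly_Mapping.keys v. Poly_Mapping.lookup v x *\<^sub>C f x)"

definition lattice_sva :: "(real^'n) set \<Rightarrow> ('n::finite) state set"
  where "lattice_sva L = {v. \<forall>x\<in>Poly_Mapping.keys v. snd x \<in> L}"

definition weight :: "'n monom \<times> (real^'n) \<Rightarrow> real"
  where "weight x = real (\<Sum>p\<in>#fst x. snd p + 1) + (snd x \<bullet> snd x) / 2"

definition has_weight :: "('n::finite) state \<Rightarrow> real \<Rightarrow> bool"
  where "has_weight v w \<longleftrightarrow> (\<forall>x\<in>Poly_Mapping.keys v. weight x = w)"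

definition is_cocycle :: "(real^'n) set \<Rightarrow> (real^'n \<Rightarrow> real^'n \<Rightarrow> complex) \<Rightarrow> bool"
  \<comment> \<open>used for integral L only, where the floors below are just conversions to \<open>int\<close>\<close>
  where "is_cocycle L \<epsilon> \<longleftrightarrow>
    (\<forall>\<alpha>\<in>L. \<forall>\<beta>\<in>L. \<epsilon> \<alpha> \<beta> \<in> {1, -1}) \<and>
    (\<forall>\<alpha>\<in>L. \<forall>\<beta>\<in>L. \<forall>\<gamma>\<in>L. \<epsilon> (\<alpha> + \<beta>) \<gamma> = \<epsilon> \<alpha> \<gamma> * \<epsilon> \<beta> \<gamma> \<and> \<epsilon> \<alpha> (\<beta> + \<gamma>) = \<epsilon> \<alpha> \<beta> * \<epsilon> \<alpha> \<gamma>) \<and>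
    (\<forall>\<alpha>\<in>L. \<forall>\<beta>\<in>L. \<epsilon> \<alpha> \<beta> * \<epsilon> \<beta> \<alpha> = (-1) powi (\<lfloor>\<alpha> \<bullet> \<beta>\<rfloor> + \<lfloor>\<alpha> \<bullet> \<alpha>\<rfloor> * \<lfloor>\<beta> \<bullet> \<beta>\<rfloor>)) \<and>
    (\<forall>\<alpha>\<in>L. \<epsilon> \<alpha> \<alpha> = (-1) powi ((\<lfloor>\<alpha> \<bullet> \<alpha>\<rfloor> + \<lfloor>\<alpha> \<bullet> \<alpha>\<rfloor>\<^sup>2) div 2))"

text \<open>
  \<open>h_i(n)\<close> is multiplication by a variable for \<open>n < 0\<close>, is n times a partial derivative for
  \<open>n > 0\<close>, and \<open>h_i(0)\<close> acts on \<open>M(1) \<otimes> e^\<beta>\<close> by \<open>(h_i, \<beta>)\<close>; hence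
  \<open>[h_i(m), h_j(n)] = m \<delta>_{ij} \<delta>_{m+n,0}\<close>.
\<close>

definition heis_basis :: "'n \<Rightarrow> int \<Rightarrow> 'n monom \<times> (real^'n) \<Rightarrow> ('n::finite) state"
  where "heis_basis i n x = (case x of (m, \<beta>) \<Rightarrow>
     if n < 0 then bstate (add_mset (i, nat (- n - 1)) m) \<beta>
     else if n = 0 then complex_of_real (\<beta> $ i) *\<^sub>C bstate m \<beta>
     else (of_int n * of_nat (count m (i, nat (n - 1)))) *\<^sub>C bstate (m - {#(i, nat (n - 1))#}) \<beta>)"

definition heis :: "'n \<Rightarrow> int \<Rightarrow> ('n::finite) state \<Rightarrow> 'n state"
  where "heis i n = lin_ext (heis_basis i n)"

definition heis_vec :: "real^'n \<Rightarrow> int \<Rightarrow> ('n::finite) state \<Rightarrow> 'n state"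
  where "heis_vec \<alpha> n v = (\<Sum>i\<in>UNIV. complex_of_real (\<alpha> $ i) *\<^sub>C heis i n v)"

text \<open>
  For operators \<open>A 1, A 2, \<dots>\<close> put \<open>A(x) = \<Sum>_{j \<ge> 1} A j x^j\<close>.  Then \<open>series_pow A r k\<close> is the
  coefficient of \<open>x^k\<close> in \<open>A(x)^r\<close> and \<open>series_exp A k\<close> that in \<open>exp(A(x)) = \<Sum>_r A(x)^r / r!\<close>.
  As \<open>A(x)\<close> has no constant term, only \<open>r \<le> k\<close> contributes.
\<close>

primrec series_pow :: "(nat \<Rightarrow> ('b \<Rightarrow>\<^sub>0 complex) \<Rightarrow> ('b \<Rightarrow>\<^sub>0 complex)) \<Rightarrow> nat \<Rightarrow> nat
    \<Rightarrow> ('b \<Rightarrow>\<^sub>0 complex) \<Rightarrow> ('b \<Rightarrow>\<^sub>0 complex)"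
  where
    "series_pow A 0 k v = (if k = 0 then v else 0)"
  | "series_pow A (Suc r) k v = (\<Sum>j=1..k. A j (series_pow A r (k - j) v))"

definition series_exp :: "(nat \<Rightarrow> ('b \<Rightarrow>\<^sub>0 complex) \<Rightarrow> ('b \<Rightarrow>\<^sub>0 complex)) \<Rightarrow> nat
    \<Rightarrow> ('b \<Rightarrow>\<^sub>0 complex) \<Rightarrow> ('b \<Rightarrow>\<^sub>0 complex)"
  where "series_exp A k v = (\<Sum>r\<le>k. (1 / fact r) *\<^sub>C series_pow A r k v)"

text \<open>
  \<open>E_cr \<alpha> j\<close> is the coefficient of \<open>z^j\<close> in \<open>exp(\<Sum>_{n \<ge> 1} \<alpha>(-n) z^n / n)\<close> and
  \<open>E_an \<alpha> k\<close> is the coefficient of \<open>z^{-k}\<close> in \<open>exp(- \<Sum>_{n \<ge> 1} \<alpha>(n) z^{-n} / n)\<close>.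
\<close>

definition E_cr :: "real^'n \<Rightarrow> nat \<Rightarrow> ('n::finite) state \<Rightarrow> 'n state"
  where "E_cr \<alpha> = series_exp (\<lambda>n v. (1 / of_nat n) *\<^sub>C heis_vec \<alpha> (- int n) v)"

definition E_an :: "real^'n \<Rightarrow> nat \<Rightarrow> ('n::finite) state \<Rightarrow> 'n state"
  where "E_an \<alpha> = series_exp (\<lambda>n v. (- 1 / of_nat n) *\<^sub>C heis_vec \<alpha> (int n) v)"

text \<open>
  \<open>Y(e^\<alpha>, z) = exp(\<Sum>_{n \<ge> 1} \<alpha>(-n) z^n / n) exp(- \<Sum>_{n \<ge> 1} \<alpha>(n) z^{-n} / n) e_\<alpha> z^\<alpha>\<close> with
  \<open>z^\<alpha> e^\<beta> = z^{(\<alpha>,\<beta>)} e^\<beta>\<close> and \<open>e_\<alpha> e^\<beta> = \<epsilon>(\<alpha>,\<beta>) e^{\<alpha>+\<beta>}\<close>; \<open>exp_mode \<epsilon> \<alpha> n\<close> is its coefficient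
  of \<open>z^{-n-1}\<close>.  Only finitely many pairs \<open>(j, k)\<close> contribute, because \<open>E_an \<alpha> k\<close> kills
  a given state for large k.
\<close>

definition exp_mode_basis ::
    "(real^'n \<Rightarrow> real^'n \<Rightarrow> complex) \<Rightarrow> real^'n \<Rightarrow> int \<Rightarrow> 'n monom \<times> (real^'n) \<Rightarrow> ('n::finite) state"
  where "exp_mode_basis \<epsilon> \<alpha> n x = (case x of (m, \<beta>) \<Rightarrow>
     Sum_any (\<lambda>(j, k).
       if real j - real k + \<alpha> \<bullet> \<beta> = of_int (- n - 1)
       then E_cr \<alpha> j (E_an \<alpha> k (\<epsilon> \<alpha> \<beta> *\<^sub>C bstate m (\<alpha> + \<beta>)))
       else 0))"

definition exp_mode ::
    "(real^'n \<Rightarrow> real^'n \<Rightarrow> complex) \<Rightarrow> real^'n \<Rightarrow> int \<Rightarrow> ('n::finite) state \<Rightarrow> 'n state"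
  where "exp_mode \<epsilon> \<alpha> n = lin_ext (exp_mode_basis \<epsilon> \<alpha> n)"

text \<open>
  Normal ordering: for \<open>u = h_{i_1}(-k_1-1) \<dots> h_{i_r}(-k_r-1) e^\<alpha>\<close>,
  \<open>Y(u, z) = : D_{k_1} h_{i_1}(z) \<dots> D_{k_r} h_{i_r}(z) Y(e^\<alpha>, z) :\<close> with
  \<open>h(z) = \<Sum>_n h(n) z^{-n-1}\<close> and \<open>D_k = (1/k!) (d/dz)^k\<close>, so
  \<open>D_k h(z) = \<Sum>_n binom(-n-1, k) h(n) z^{-n-1-k}\<close>.  Creation operators (\<open>n < 0\<close>) are put to the
  left and annihilation operators (\<open>n \<ge> 0\<close>, including \<open>h(0)\<close>) to the right.
  In each state, only finitely many n contribute.
\<close>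

primrec monom_mode ::
    "(real^'n \<Rightarrow> real^'n \<Rightarrow> complex) \<Rightarrow> ('n \<times> nat) list \<Rightarrow> real^'n \<Rightarrow> int
     \<Rightarrow> ('n::finite) state \<Rightarrow> 'n state"
  where
    "monom_mode \<epsilon> [] \<alpha> p v = exp_mode \<epsilon> \<alpha> p v"
  | "monom_mode \<epsilon> (x # xs) \<alpha> p v = (case x of (i, k) \<Rightarrow>
       Sum_any (\<lambda>n::int. ((of_int (- n - 1) :: complex) gchoose k) *\<^sub>C
         (if n < 0 then heis i n (monom_mode \<epsilon> xs \<alpha> (p - n - int k - 1) v)
          else monom_mode \<epsilon> xs \<alpha> (p - n - int k - 1) (heis i n v))))"

text \<open>
  \<open>mode \<epsilon> u p\<close> is the operator \<open>u(p)\<close> in \<open>Y(u, z) = \<Sum>_p u(p) z^{-p-1}\<close>.  The enumeration of the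
  monomial m is immaterial: the creation operators commute with each other, and so do the
  annihilation operators.
\<close>

definition mode ::
    "(real^'n \<Rightarrow> real^'n \<Rightarrow> complex) \<Rightarrow> ('n::finite) state \<Rightarrow> int \<Rightarrow> 'n state \<Rightarrow> 'n state"
  where "mode \<epsilon> u p v =
    lin_ext (\<lambda>(m, \<alpha>). monom_mode \<epsilon> (SOME xs. mset xs = m) \<alpha> p v) u"

definition transl :: "(real^'n \<Rightarrow> real^'n \<Rightarrow> complex) \<Rightarrow> ('n::finite) state \<Rightarrow> 'n state"
  where "transl \<epsilon> u = mode \<epsilon> u (-2) vac"

definition lattice_virasoro :: "('n::finite) state"
  where "lattice_virasoro = (1/2) *\<^sub>C (\<Sum>i\<in>UNIV. heis i (-1) (heis i (-1) vac))"

text \<open>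
  The products may be bracketed arbitrarily, so that the result is visibly closed under all
  \<open>u(n)v\<close>.  By the iterate formula of the vertex superalgebra \<open>V_L\<close> it is the span of the states
  \<open>u_1(n_1) \<dots> u_k(n_k) vac\<close> with all \<open>u_i \<in> S\<close>.
\<close>

inductive_set generated_subalgebra ::
    "(real^'n \<Rightarrow> real^'n \<Rightarrow> complex) \<Rightarrow> ('n::finite) state set \<Rightarrow> 'n state set"
  for \<epsilon> S
  where
    vac: "vac \<in> generated_subalgebra \<epsilon> S"
  | gen: "u \<in> S \<Longrightarrow> u \<in> generated_subalgebra \<epsilon> S"
  | add: "u \<in> generated_subalgebra \<epsilon> S \<Longrightarrow> v \<in> generated_subalgebra \<epsilon> S
          \<Longrightarrow> u + v \<in> generated_subalgebra \<epsilon> S"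
  | scale: "u \<in> generated_subalgebra \<epsilon> S \<Longrightarrow> c *\<^sub>C u \<in> generated_subalgebra \<epsilon> S"
  | product: "u \<in> generated_subalgebra \<epsilon> S \<Longrightarrow> v \<in> generated_subalgebra \<epsilon> S
          \<Longrightarrow> mode \<epsilon> u n v \<in> generated_subalgebra \<epsilon> S"

text \<open>
  \<open>products \<epsilon> u v [w_0, \<dots>, w_r]\<close> lists all nonnegative products of u and v:
  \<open>u(n)v = w_n\<close> for \<open>n \<le> r\<close> and \<open>u(n)v = 0\<close> for \<open>n > r\<close>.
\<close>

definition products ::
    "(real^'n \<Rightarrow> real^'n \<Rightarrow> complex) \<Rightarrow> ('n::finite) state \<Rightarrow> 'n state \<Rightarrow> 'n state list \<Rightarrow> bool"
  where "products \<epsilon> u v ws \<longleftrightarrow>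
    (\<forall>n::nat. mode \<epsilon> u (int n) v = (if n < length ws then ws ! n else 0))"

definition virasoro_element ::
    "(real^'n \<Rightarrow> real^'n \<Rightarrow> complex) \<Rightarrow> complex \<Rightarrow> ('n::finite) state \<Rightarrow> bool"
  where "virasoro_element \<epsilon> c \<omega> \<longleftrightarrow>
    products \<epsilon> \<omega> \<omega> [transl \<epsilon> \<omega>, 2 *\<^sub>C \<omega>, 0, (c / 2) *\<^sub>C vac]"

definition primary ::
    "(real^'n \<Rightarrow> real^'n \<Rightarrow> complex) \<Rightarrow> ('n::finite) state \<Rightarrow> complex \<Rightarrow> 'n state \<Rightarrow> bool"
  where "primary \<epsilon> \<omega> w u \<longleftrightarrow> products \<epsilon> \<omega> u [transl \<epsilon> u, w *\<^sub>C u]"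

text \<open>
  The Virasoro relations are stated, like all the other relations, as products of states (the
  operator product expansion of \<open>\<omega>\<close> with itself); \<open>L(n) = \<omega>(n+1)\<close>.
  For each unordered pair of the states \<open>G\<^sup>\<plusminus>, Gbar\<^sup>\<plusminus>, J\<^sup>\<plusminus>, J\<^sup>0, \<omega>\<close> all nonnegative products
  are prescribed in at least one order, the zero ones included; the products in the other order
  are determined from these by super skew-symmetry.
\<close>

definition N4_relations ::
    "(real^'n \<Rightarrow> real^'n \<Rightarrow> complex) \<Rightarrow> complex \<Rightarrow> ('n::finite) state \<Rightarrow>
     'n state \<Rightarrow> 'n state \<Rightarrow> 'n state \<Rightarrow> 'n state \<Rightarrow> 'n state \<Rightarrow> 'n state \<Rightarrow> 'n state \<Rightarrow> bool"
  where "N4_relations \<epsilon> c \<omega> Gp Gm Gbp Gbm Jp Jm J0 \<longleftrightarrow>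
    virasoro_element \<epsilon> c \<omega> \<and>
    (\<forall>J\<in>{Jp, Jm, J0}. primary \<epsilon> \<omega> 1 J) \<and>
    (\<forall>G\<in>{Gp, Gm, Gbp, Gbm}. primary \<epsilon> \<omega> (3/2) G) \<and>
    products \<epsilon> J0 Jp [2 *\<^sub>C Jp] \<and>
    products \<epsilon> J0 Jm [(-2) *\<^sub>C Jm] \<and>
    products \<epsilon> J0 J0 [0, (c / 3) *\<^sub>C vac] \<and>
    products \<epsilon> Jp Jm [J0, (c / 6) *\<^sub>C vac] \<and>
    products \<epsilon> Jp Jp [] \<and>
    products \<epsilon> Jm Jm [] \<and>
    products \<epsilon> J0 Gp [Gp] \<and>
    products \<epsilon> J0 Gm [- Gm] \<and>
    products \<epsilon> J0 Gbp [Gbp] \<and>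
    products \<epsilon> J0 Gbm [- Gbm] \<and>
    products \<epsilon> Jp Gm [Gp] \<and>
    products \<epsilon> Jm Gp [Gm] \<and>
    products \<epsilon> Jp Gbm [- Gbp] \<and>
    products \<epsilon> Jm Gbp [- Gbm] \<and>
    products \<epsilon> Jp Gp [] \<and>
    products \<epsilon> Jm Gm [] \<and>
    products \<epsilon> Jp Gbp [] \<and>
    products \<epsilon> Jm Gbm [] \<and>
    products \<epsilon> Gp Gbp [transl \<epsilon> Jp, 2 *\<^sub>C Jp] \<and>
    products \<epsilon> Gm Gbm [transl \<epsilon> Jm, 2 *\<^sub>C Jm] \<and>
    products \<epsilon> Gp Gbm [\<omega> + (1/2) *\<^sub>C transl \<epsilon> J0, J0, (c / 3) *\<^sub>C vac] \<and>
    products \<epsilon> Gm Gbp [\<omega> - (1/2) *\<^sub>C transl \<epsilon> J0, - J0, (c / 3) *\<^sub>C vac] \<and>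
    (\<forall>X\<in>{Gp, Gm}. \<forall>Y\<in>{Gp, Gm}. products \<epsilon> X Y []) \<and>
    (\<forall>X\<in>{Gbp, Gbm}. \<forall>Y\<in>{Gbp, Gbm}. products \<epsilon> X Y [])"

definition N4_subalgebra ::
    "(real^'n) set \<Rightarrow> (real^'n \<Rightarrow> real^'n \<Rightarrow> complex) \<Rightarrow> complex \<Rightarrow> ('n::finite) state
     \<Rightarrow> 'n state set \<Rightarrow> bool"
  where "N4_subalgebra L \<epsilon> c \<omega> A \<longleftrightarrow>
    A \<subseteq> lattice_sva L \<and>
    (\<exists>Gp Gm Gbp Gbm Jp Jm J0.
       A = generated_subalgebra \<epsilon> {Gp, Gm, Gbp, Gbm} \<and>
       (\<forall>G\<in>{Gp, Gm, Gbp, Gbm}. has_weight G (3/2)) \<and>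
       (\<forall>J\<in>{Jp, Jm, J0}. J \<in> A \<and> has_weight J 1) \<and>
       \<omega> \<in> A \<and>
       N4_relations \<epsilon> c \<omega> Gp Gm Gbp Gbm Jp Jm J0)"

end

theory Submission
  imports Defs
begin

text \<open>
  The norm 2 vector \<open>h\<close> gives \<open>J\<^sup>0 = h\<close> and \<open>J\<^sup>\<plusminus> = \<plusminus>e\<^sup>\<plusminus>\<^sup>h\<close>; the sign is forced by
  \<open>\<epsilon>(h, h) = -1\<close>.  The states of weight \<open>3/2\<close> and charge 1 are spanned by \<open>e^{\<alpha>_i}\<close> and
  \<open>e^{h - \<alpha>_i}\<close>.  Take \<open>G\<^sup>+ = \<Sum>_i e^{\<alpha>_i}\<close> and \<open>Gbar\<^sup>- = 1/3 \<Sum>_i e^{-\<alpha>_i}\<close>, and apply \<open>J\<^sup>-(0)\<close> and \<open>-J\<^sup>+(0)\<close> to get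
  \<open>G\<^sup>- = - \<Sum>_i s_i e^{\<alpha>_i - h}\<close> and \<open>Gbar\<^sup>+ = - 1/3 \<Sum>_i s_i e^{h - \<alpha>_i}\<close>, where \<open>s_i = \<epsilon>(h, \<alpha>_i)\<close>.
  Exponents of two generators have inner product at least \<open>-3\<close>, so that only the first three terms
  of the creation exponential matter.  In \<open>G\<^sup>+(0) Gbar\<^sup>-\<close> the quadratic part is
  \<open>1/6 \<Sum>_i \<alpha>_i(-1)\<^sup>2\<close>, which is the Virasoro vector because the \<open>\<alpha>_i / sqrt 3\<close> are orthonormal.
  The product \<open>G\<^sup>+(0) G\<^sup>-\<close> vanishes because \<open>\<epsilon>(\<alpha>_i, \<alpha>_j) = - \<epsilon>(\<alpha>_j, \<alpha>_i)\<close> for \<open>i \<noteq> j\<close>.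
\<close>

subsection \<open>Linear operators on states\<close>

lemma lookup_scale [simp]: "Poly_Mapping.lookup (c *\<^sub>C v) x = c * Poly_Mapping.lookup v x"
  by (simp add: scale_def Poly_Mapping.map.rep_eq when_def)

interpretation scale: vector_space "scale :: complex \<Rightarrow> ('b \<Rightarrow>\<^sub>0 complex) \<Rightarrow> ('b \<Rightarrow>\<^sub>0 complex)"
  by standard (auto intro!: poly_mapping_eqI simp: lookup_add algebra_simps)

lemma scale_single: "c *\<^sub>C Poly_Mapping.single x d = Poly_Mapping.single x (c * d)"
  by (rule poly_mapping_eqI) (simp add: lookup_single when_def)

abbreviation "linear_op \<equiv> module_hom scale scale"

lemma linear_opI:
  assumes "\<And>u v. f (u + v) = f u + f v" "\<And>c v. f (c *\<^sub>C v) = c *\<^sub>C f v"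
  shows "linear_op f"
  by unfold_locales (use assms in auto)

text \<open>Enlarging the support to a finite superset only adds zero terms, so that two states can
  be summed over one common index set.\<close>

lemma lin_ext_superset:
  assumes "finite K" "Poly_Mapping.keys v \<subseteq> K"
  shows "lin_ext f v = (\<Sum>x\<in>K. Poly_Mapping.lookup v x *\<^sub>C f x)"
  unfolding lin_ext_def using assms by (intro sum.mono_neutral_left) (auto simp: in_keys_iff)

lemma linear_lin_ext: "linear_op (lin_ext f)"
proof (rule linear_opI)
  show "lin_ext f (u + v) = lin_ext f u + lin_ext f v" for u v
  proof -
    let ?K = "Poly_Mapping.keys u \<union> Poly_Mapping.keys v"
    have "Poly_Mapping.keys (u + v) \<subseteq> ?K" by (rule Poly_Mapping.keys_add)
    then show ?thesis
      by (simp add: lin_ext_superset[of ?K] lookup_add scale.scale_left_distrib sum.distrib)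
  qed
  show "lin_ext f (c *\<^sub>C v) = c *\<^sub>C lin_ext f v" for c v
  proof -
    have "Poly_Mapping.keys (c *\<^sub>C v) \<subseteq> Poly_Mapping.keys v" by (auto simp: in_keys_iff)
    then show ?thesis
      by (simp add: lin_ext_superset[of "Poly_Mapping.keys v"] scale.scale_sum_right)
  qed
qed

lemma lin_ext_single: "lin_ext f (Poly_Mapping.single x c) = c *\<^sub>C f x"
  by (simp add: lin_ext_superset[of "{x}"])

lemma lin_ext_bstate [simp]: "lin_ext f (bstate m \<beta>) = f (m, \<beta>)"
  by (simp add: bstate_def lin_ext_single)

lemma linear_op_sum_fun:
  assumes "\<And>i. i \<in> I \<Longrightarrow> linear_op (f i)"
  shows "linear_op (\<lambda>v. \<Sum>i\<in>I. f i v)"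
  by (rule linear_opI)
    (auto simp: scale.scale_sum_right sum.distrib[symmetric] module_hom.add[OF assms]
      module_hom.scale[OF assms] intro!: sum.cong)

lemma linear_op_scale_fun: "linear_op f \<Longrightarrow> linear_op (\<lambda>v. c *\<^sub>C f v)"
  by (rule linear_opI)
    (auto simp: module_hom.add module_hom.scale scale.scale_right_distrib mult.commute)

lemma linear_heis: "linear_op (heis i n)"
  unfolding heis_def by (rule linear_lin_ext)

lemma linear_heis_vec: "linear_op (heis_vec \<alpha> n)"
  unfolding heis_vec_def[abs_def] by (intro linear_op_sum_fun linear_op_scale_fun linear_heis)

lemma linear_exp_mode: "linear_op (exp_mode \<epsilon> \<alpha> n)"
  unfolding exp_mode_def by (rule linear_lin_ext)

lemma linear_mode_left: "linear_op (\<lambda>u. mode \<epsilon> u p v)"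
  unfolding mode_def by (rule linear_lin_ext)


lemmas heis_linear = module_hom.add[OF linear_heis] module_hom.scale[OF linear_heis]
  module_hom.sum[OF linear_heis] module_hom.zero[OF linear_heis] module_hom.neg[OF linear_heis]

lemmas heis_vec_linear = module_hom.add[OF linear_heis_vec] module_hom.scale[OF linear_heis_vec]
  module_hom.sum[OF linear_heis_vec] module_hom.zero[OF linear_heis_vec]
  module_hom.neg[OF linear_heis_vec]

lemma heis_vec_zero_vec [simp]: "heis_vec 0 n v = 0"
  by (simp add: heis_vec_def)

lemma heis_vec_sum: "heis_vec (\<Sum>i\<in>I. f i) n v = (\<Sum>i\<in>I. heis_vec (f i) n v)"
proof -
  have "heis_vec (\<Sum>i\<in>I. f i) n v
      = (\<Sum>j\<in>UNIV. \<Sum>i\<in>I. complex_of_real (f i $ j) *\<^sub>C heis j n v)"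
    by (simp add: heis_vec_def scale.scale_sum_left)
  also have "\<dots> = (\<Sum>i\<in>I. \<Sum>j\<in>UNIV. complex_of_real (f i $ j) *\<^sub>C heis j n v)"
    by (rule sum.swap)
  finally show ?thesis by (simp add: heis_vec_def)
qed

lemma heis_vec_scaleR: "heis_vec (r *\<^sub>R \<alpha>) n v = complex_of_real r *\<^sub>C heis_vec \<alpha> n v"
  by (simp add: heis_vec_def scale.scale_sum_right)

lemma heis_vec_minus: "heis_vec (- \<alpha>) n v = - heis_vec \<alpha> n v"
  by (simp add: heis_vec_def sum_negf)

subsection \<open>Heisenberg operators and vertex operators\<close>

lemma heis_bstate: "heis i n (bstate m \<beta>) = heis_basis i n (m, \<beta>)"
  by (simp add: heis_def)

lemma heis_bstate_empty_pos: "n > 0 \<Longrightarrow> heis i n (bstate {#} \<beta>) = 0"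
  by (simp add: heis_bstate heis_basis_def)

lemma heis_zero_bstate: "heis i 0 (bstate m \<beta>) = complex_of_real (\<beta> $ i) *\<^sub>C bstate m \<beta>"
  by (simp add: heis_bstate heis_basis_def)

lemma heis_vec_bstate_empty_pos: "n > 0 \<Longrightarrow> heis_vec \<alpha> n (bstate {#} \<beta>) = 0"
  by (simp add: heis_vec_def heis_bstate_empty_pos)

lemma heis_vec_zero_bstate:
  "heis_vec \<alpha> 0 (bstate m \<beta>) = complex_of_real (\<alpha> \<bullet> \<beta>) *\<^sub>C bstate m \<beta>"
  by (simp add: heis_vec_def heis_zero_bstate inner_vec_def scale.scale_sum_left)

lemma linear_series_pow:
  assumes "\<And>j. linear_op (A j)"
  shows "linear_op (series_pow A r k)"
proof (induction r arbitrary: k)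
  case 0
  show ?case by (rule linear_opI) auto
next
  case (Suc r)
  have "linear_op (\<lambda>v. \<Sum>j=1..k. A j (series_pow A r (k - j) v))"
    by (intro linear_op_sum_fun linear_opI)
      (simp_all add: module_hom.add[OF assms] module_hom.scale[OF assms]
        module_hom.add[OF Suc] module_hom.scale[OF Suc])
  moreover have "series_pow A (Suc r) k = (\<lambda>v. \<Sum>j=1..k. A j (series_pow A r (k - j) v))"
    by (rule ext) simp
  ultimately show ?case by simp
qed

lemma linear_series_exp:
  assumes "\<And>j. linear_op (A j)"
  shows "linear_op (series_exp A k)"
  unfolding series_exp_def[abs_def]
  by (intro linear_op_sum_fun linear_op_scale_fun linear_series_pow assms)

text \<open>For \<open>r > 0\<close> the innermost factor of every term is some \<open>A j\<close>
  with \<open>j \<ge> 1\<close>, and it kills \<open>v\<close>. Only the constant term of the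
  exponential survives; this covers the annihilation exponential on \<open>e^\<beta>\<close> as well
  as both exponentials of the zero vector.\<close>

lemma series_pow_annihilated:
  assumes "\<And>j. j \<ge> 1 \<Longrightarrow> A j v = 0" "\<And>j. A j 0 = 0"
  shows "series_pow A r k v = (if r = 0 \<and> k = 0 then v else 0)"
proof (induction r arbitrary: k)
  case (Suc r)
  have "A j (series_pow A r (k - j) v) = 0" if "j \<in> {1..k}" for j
    using that by (simp add: Suc.IH assms)
  then show ?case by (simp del: One_nat_def)
qed simp

lemma series_exp_annihilated:
  assumes "\<And>j. j \<ge> 1 \<Longrightarrow> A j v = 0" "\<And>j. A j 0 = 0"
  shows "series_exp A k v = (if k = 0 then v else 0)"
  by (auto simp: series_exp_def series_pow_annihilated[OF assms] if_distrib cong: if_cong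
      intro!: sum.neutral)

lemma linear_E_cr: "linear_op (E_cr \<alpha> k)"
  unfolding E_cr_def by (intro linear_series_exp linear_op_scale_fun linear_heis_vec)

lemma linear_E_an: "linear_op (E_an \<alpha> k)"
  unfolding E_an_def by (intro linear_series_exp linear_op_scale_fun linear_heis_vec)

lemma E_an_bstate_empty: "E_an \<alpha> k (bstate {#} \<beta>) = (if k = 0 then bstate {#} \<beta> else 0)"
  unfolding E_an_def
  by (rule series_exp_annihilated) (simp_all add: heis_vec_bstate_empty_pos heis_vec_linear)

lemma E_an_zero: "E_an 0 k v = (if k = 0 then v else 0)"
  unfolding E_an_def by (rule series_exp_annihilated) simp_all

lemma E_cr_zero: "E_cr 0 k v = (if k = 0 then v else 0)"
  unfolding E_cr_def by (rule series_exp_annihilated) simp_all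

lemma E_cr_0: "E_cr \<alpha> 0 v = v"
  by (simp add: E_cr_def series_exp_def)

lemma E_cr_1: "E_cr \<alpha> (Suc 0) v = heis_vec \<alpha> (-1) v"
  by (simp add: E_cr_def series_exp_def)

text \<open>The linear part of the series contributes the half of \<alpha>(-2), its square the half
  of \<alpha>(-1)\<alpha>(-1).\<close>

lemma E_cr_2: "E_cr \<alpha> (Suc (Suc 0)) v
    = (1/2) *\<^sub>C (heis_vec \<alpha> (-1) (heis_vec \<alpha> (-1) v) + heis_vec \<alpha> (-2) v)"
  by (simp add: E_cr_def series_exp_def heis_vec_linear scale.scale_right_distrib fact_reduce)

text \<open>Only \<open>k = 0\<close> survives annihilation, so matching powers of z forces
  \<open>j = - n - 1 - N\<close>, a natural number exactly when \<open>n + N < 0\<close>. The first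
  assumption is abstract in order to serve both \<open>m = {#}\<close> and
  \<open>\<alpha> = 0\<close>.\<close>

lemma exp_mode_bstate:
  assumes an: "\<And>k. E_an \<alpha> k (bstate m (\<alpha> + \<beta>)) = (if k = 0 then bstate m (\<alpha> + \<beta>) else 0)"
    and N: "\<alpha> \<bullet> \<beta> = of_int N"
  shows "exp_mode \<epsilon> \<alpha> n (bstate m \<beta>) =
    (if n + N < 0 then \<epsilon> \<alpha> \<beta> *\<^sub>C E_cr \<alpha> (nat (- n - 1 - N)) (bstate m (\<alpha> + \<beta>)) else 0)"
proof -
  define g where "g = (\<lambda>(j, k). if real j - real k + \<alpha> \<bullet> \<beta> = of_int (- n - 1)
       then E_cr \<alpha> j (E_an \<alpha> k (\<epsilon> \<alpha> \<beta> *\<^sub>C bstate m (\<alpha> + \<beta>))) else 0)"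
  define j0 where "j0 = nat (- n - 1 - N)"
  have g: "g (j, k) = (if n + N < 0 \<and> j = j0 \<and> k = 0
      then \<epsilon> \<alpha> \<beta> *\<^sub>C E_cr \<alpha> j0 (bstate m (\<alpha> + \<beta>)) else 0)" for j k
  proof -
    have "real j + \<alpha> \<bullet> \<beta> = of_int (- n - 1) \<longleftrightarrow> int j + N = - n - 1"
      unfolding N by linarith
    also have "\<dots> \<longleftrightarrow> n + N < 0 \<and> j = j0"
      unfolding j0_def by auto
    finally show ?thesis
      by (auto simp: g_def an module_hom.scale[OF linear_E_an] module_hom.scale[OF linear_E_cr]
          module_hom.zero[OF linear_E_cr])
  qed
  have "exp_mode \<epsilon> \<alpha> n (bstate m \<beta>) = Sum_any g"
    by (simp add: exp_mode_def exp_mode_basis_def g_def)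
  also have "\<dots> = sum g {(j0, 0)}"
    by (rule Sum_any.expand_superset) (auto simp: g split: if_splits)
  finally show ?thesis by (simp add: g j0_def)
qed

lemma exp_mode_bstate_empty:
  assumes "\<alpha> \<bullet> \<beta> = of_int N"
  shows "exp_mode \<epsilon> \<alpha> n (bstate {#} \<beta>) =
    (if n + N < 0 then \<epsilon> \<alpha> \<beta> *\<^sub>C E_cr \<alpha> (nat (- n - 1 - N)) (bstate {#} (\<alpha> + \<beta>)) else 0)"
  by (rule exp_mode_bstate[OF E_an_bstate_empty assms])

subsection \<open>Closure of the lattice algebra under modes\<close>

lemma subspace_lattice_sva: "scale.subspace (lattice_sva L)"
proof (rule scale.subspaceI)
  show "u + v \<in> lattice_sva L" if "u \<in> lattice_sva L" "v \<in> lattice_sva L" for u v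
    using that Poly_Mapping.keys_add[of u v] unfolding lattice_sva_def by blast
  show "c *\<^sub>C v \<in> lattice_sva L" if "v \<in> lattice_sva L" for c v
    using that by (simp add: lattice_sva_def in_keys_iff)
qed (simp add: lattice_sva_def)

text \<open>Over an infinite support \<open>Sum_any\<close> takes the default value 0, which lies in
  the subspace as well.\<close>

lemma Sum_any_mem_subspace:
  assumes "scale.subspace V" "\<And>i. g i \<in> V"
  shows "Sum_any g \<in> V"
  unfolding Sum_any.expand_set by (intro scale.subspace_sum assms)

lemma lin_ext_mem_subspace:
  assumes "scale.subspace V" "\<And>x. x \<in> Poly_Mapping.keys v \<Longrightarrow> f x \<in> V"
  shows "lin_ext f v \<in> V"
  unfolding lin_ext_def by (intro scale.subspace_sum scale.subspace_scale assms)

lemma bstate_mem_lattice_sva [simp]: "bstate m \<beta> \<in> lattice_sva L \<longleftrightarrow> \<beta> \<in> L"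
  by (simp add: lattice_sva_def bstate_def)

lemma heis_mem: "v \<in> lattice_sva L \<Longrightarrow> heis i n v \<in> lattice_sva L"
  unfolding heis_def
  by (rule lin_ext_mem_subspace[OF subspace_lattice_sva])
    (auto simp: heis_basis_def lattice_sva_def[of L] bstate_def scale_single
      dest: in_keys_iff[THEN iffD1] split: if_splits)

lemma heis_vec_mem: "v \<in> lattice_sva L \<Longrightarrow> heis_vec \<alpha> n v \<in> lattice_sva L"
  unfolding heis_vec_def
  by (intro scale.subspace_sum scale.subspace_scale subspace_lattice_sva heis_mem)

lemma series_pow_mem:
  assumes "scale.subspace V" "\<And>j u. u \<in> V \<Longrightarrow> A j u \<in> V" "v \<in> V"
  shows "series_pow A r k v \<in> V"
  by (induction r arbitrary: k)
    (auto simp: assms scale.subspace_0[OF assms(1)] intro!: scale.subspace_sum[OF assms(1)])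

lemma series_exp_mem:
  assumes "scale.subspace V" "\<And>j u. u \<in> V \<Longrightarrow> A j u \<in> V" "v \<in> V"
  shows "series_exp A k v \<in> V"
  unfolding series_exp_def
  by (intro scale.subspace_sum[OF assms(1)] scale.subspace_scale[OF assms(1)] series_pow_mem assms)

lemma E_cr_mem: "v \<in> lattice_sva L \<Longrightarrow> E_cr \<alpha> k v \<in> lattice_sva L"
  unfolding E_cr_def
  by (intro series_exp_mem scale.subspace_scale subspace_lattice_sva heis_vec_mem)

lemma E_an_mem: "v \<in> lattice_sva L \<Longrightarrow> E_an \<alpha> k v \<in> lattice_sva L"
  unfolding E_an_def
  by (intro series_exp_mem scale.subspace_scale subspace_lattice_sva heis_vec_mem)

lemma exp_mode_mem:
  assumes "\<And>\<beta>. \<beta> \<in> L \<Longrightarrow> \<alpha> + \<beta> \<in> L" "v \<in> lattice_sva L"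
  shows "exp_mode \<epsilon> \<alpha> n v \<in> lattice_sva L"
  unfolding exp_mode_def
proof (rule lin_ext_mem_subspace[OF subspace_lattice_sva])
  fix x assume x: "x \<in> Poly_Mapping.keys v"
  obtain m \<beta> where [simp]: "x = (m, \<beta>)" by fastforce
  have "\<beta> \<in> L" using x assms(2) by (force simp: lattice_sva_def)
  then show "exp_mode_basis \<epsilon> \<alpha> n x \<in> lattice_sva L"
    unfolding exp_mode_basis_def
    by (auto intro!: Sum_any_mem_subspace[OF subspace_lattice_sva] E_cr_mem E_an_mem
        scale.subspace_scale[OF subspace_lattice_sva] scale.subspace_0[OF subspace_lattice_sva] assms)
qed

lemma monom_mode_mem:
  assumes "\<And>\<beta>. \<beta> \<in> L \<Longrightarrow> \<alpha> + \<beta> \<in> L" "v \<in> lattice_sva L"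
  shows "monom_mode \<epsilon> xs \<alpha> p v \<in> lattice_sva L"
  using assms(2)
proof (induction xs arbitrary: p v)
  case Nil
  then show ?case by (simp add: exp_mode_mem assms)
next
  case (Cons x xs)
  obtain i k where x: "x = (i, k)" by fastforce
  have "(c gchoose k) *\<^sub>C (if n < 0 then heis i n (monom_mode \<epsilon> xs \<alpha> q v)
      else monom_mode \<epsilon> xs \<alpha> q (heis i n v)) \<in> lattice_sva L" for c q n
    using Cons by (simp add: scale.subspace_scale[OF subspace_lattice_sva] heis_mem)
  then show ?case
    by (simp add: x Sum_any_mem_subspace[OF subspace_lattice_sva])
qed

lemma mode_mem:
  assumes "\<And>\<alpha> \<beta>. \<alpha> \<in> L \<Longrightarrow> \<beta> \<in> L \<Longrightarrow> \<alpha> + \<beta> \<in> L" "u \<in> lattice_sva L" "v \<in> lattice_sva L"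
  shows "mode \<epsilon> u p v \<in> lattice_sva L"
  unfolding mode_def
proof (rule lin_ext_mem_subspace[OF subspace_lattice_sva])
  fix x assume x: "x \<in> Poly_Mapping.keys u"
  obtain m \<beta> where [simp]: "x = (m, \<beta>)" by fastforce
  have "\<beta> \<in> L" using x assms(2) by (force simp: lattice_sva_def)
  then show "(case x of (m, \<alpha>) \<Rightarrow> monom_mode \<epsilon> (SOME xs. mset xs = m) \<alpha> p v) \<in> lattice_sva L"
    by (auto intro!: monom_mode_mem assms)
qed

lemma generated_subalgebra_subset:
  assumes "\<And>\<alpha> \<beta>. \<alpha> \<in> L \<Longrightarrow> \<beta> \<in> L \<Longrightarrow> \<alpha> + \<beta> \<in> L" "0 \<in> L" "S \<subseteq> lattice_sva L"
  shows "generated_subalgebra \<epsilon> S \<subseteq> lattice_sva L"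
proof
  fix u assume "u \<in> generated_subalgebra \<epsilon> S"
  then show "u \<in> lattice_sva L"
    using assms(3)
    by induction
      (auto simp: vac_def assms(2) intro: mode_mem assms(1)
        scale.subspace_add[OF subspace_lattice_sva] scale.subspace_scale[OF subspace_lattice_sva])
qed

subsection \<open>Heisenberg operators on low-weight states\<close>

text \<open>Serves to recognise the mode -1 of the vacuum, computed basis vector by basis vector, as
  the identity operator.\<close>

lemma lin_ext_bstate_id: "lin_ext (\<lambda>(m, \<beta>). bstate m \<beta>) v = v"
  by (rule poly_mapping_eqI)
    (auto simp: lin_ext_def bstate_def lookup_sum lookup_single when_def in_keys_iff split_def
      if_distrib cong: if_cong)

lemma lattice_virasoro_eq:
  "lattice_virasoro = (1/2) *\<^sub>C (\<Sum>i\<in>UNIV. bstate {#(i, 0), (i, 0)#} 0)"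
  by (simp add: lattice_virasoro_def vac_def heis_bstate heis_basis_def)

lemma heis_vec_vac: "heis_vec \<alpha> (-1) vac = (\<Sum>i\<in>UNIV. complex_of_real (\<alpha> $ i) *\<^sub>C bstate {#(i, 0)#} 0)"
  by (simp add: heis_vec_def vac_def heis_bstate heis_basis_def)

lemma heis_vac: "n \<ge> 0 \<Longrightarrow> heis i n vac = 0"
  by (simp add: heis_bstate heis_basis_def vac_def)

lemma heis_vec_vac_nonneg: "n \<ge> 0 \<Longrightarrow> heis_vec \<alpha> n vac = 0"
  by (simp add: heis_vec_def heis_vac)

lemma heis_heis_vac:
  assumes "n \<ge> 0"
  shows "heis i n (heis j (-1) vac) = (if n = 1 \<and> i = j then vac else 0)"
  using assms by (auto simp: heis_bstate heis_basis_def vac_def)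

lemma heis_heis_heis_vac:
  assumes "n \<ge> 0"
  shows "heis i n (heis j (-1) (heis j (-1) vac)) = (if n = 1 \<and> i = j then 2 *\<^sub>C heis j (-1) vac else 0)"
  using assms by (auto simp: heis_bstate heis_basis_def vac_def)

lemma heis_heis_vec_vac:
  assumes "n \<ge> 0"
  shows "heis i n (heis_vec \<alpha> (-1) vac) = (if n = 1 then complex_of_real (\<alpha> $ i) *\<^sub>C vac else 0)"
  using assms
  by (simp add: heis_vec_def heis_linear heis_heis_vac if_distrib cong: if_cong)

text \<open>The two contractions of h_i(1) with the square of h_i(-1) cancel the factor 1/2.\<close>

lemma heis_lattice_virasoro:
  assumes "n \<ge> 0"
  shows "heis i n lattice_virasoro = (if n = 1 then heis i (-1) vac else 0)"
  using assms
  by (simp add: lattice_virasoro_def heis_linear heis_heis_heis_vac if_distrib cong: if_cong)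

text \<open>Expanding in coordinates yields the coefficient matrix of the h_a(-1)h_b(-1), which the
  frame condition makes \<open>c\<close> times the identity matrix. The factor 2 undoes the 1/2 in
  the Virasoro vector.\<close>

lemma lattice_virasoro_from_frame:
  assumes "\<And>a b. (\<Sum>i\<in>I. f i $ a * f i $ b) = (if a = b then c else 0)"
  shows "(\<Sum>i\<in>I. heis_vec (f i) (-1) (heis_vec (f i) (-1) vac)) = complex_of_real (2 * c) *\<^sub>C lattice_virasoro"
proof -
  let ?h = "\<lambda>a b. heis a (-1) (heis b (-1) vac)"
  have "(\<Sum>i\<in>I. heis_vec (f i) (-1) (heis_vec (f i) (-1) vac))
      = (\<Sum>i\<in>I. \<Sum>a\<in>UNIV. \<Sum>b\<in>UNIV. complex_of_real (f i $ a * f i $ b) *\<^sub>C ?h a b)"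
    by (simp add: heis_vec_def heis_linear scale.scale_sum_right)
  also have "\<dots> = (\<Sum>a\<in>UNIV. \<Sum>i\<in>I. \<Sum>b\<in>UNIV. complex_of_real (f i $ a * f i $ b) *\<^sub>C ?h a b)"
    by (rule sum.swap)
  also have "\<dots> = (\<Sum>a\<in>UNIV. \<Sum>b\<in>UNIV. \<Sum>i\<in>I. complex_of_real (f i $ a * f i $ b) *\<^sub>C ?h a b)"
    by (intro sum.cong refl sum.swap)
  also have "\<dots> = (\<Sum>a\<in>UNIV. \<Sum>b\<in>UNIV. complex_of_real (if a = b then c else 0) *\<^sub>C ?h a b)"
    by (simp only: scale.scale_sum_left[symmetric] of_real_sum[symmetric] assms)
  also have "\<dots> = (\<Sum>a\<in>UNIV. complex_of_real c *\<^sub>C ?h a a)"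
    by (simp add: if_distrib[of complex_of_real] if_distrib[of "\<lambda>x. x *\<^sub>C _"] cong: if_cong)
  also have "\<dots> = complex_of_real (2 * c) *\<^sub>C lattice_virasoro"
    by (simp add: lattice_virasoro_def scale.scale_sum_right)
  finally show ?thesis .
qed

lemma mode_bstate_empty: "mode \<epsilon> (bstate {#} \<beta>) p v = exp_mode \<epsilon> \<beta> p v"
  by (simp add: mode_def)

text \<open>\<open>mode\<close> picks some enumeration of a monomial. A single letter, or one letter
  taken twice, has exactly one enumeration, so the choice is determined.\<close>

lemma mset_eq_singleton: "mset xs = {#a#} \<longleftrightarrow> xs = [a]"
  by auto

lemma mset_eq_pair_same: "mset xs = {#a, a#} \<longleftrightarrow> xs = [a, a]"
proof
  assume xs: "mset xs = {#a, a#}"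
  have "xs = replicate (Suc (Suc 0)) a"
    using arg_cong[OF xs, of size] arg_cong[OF xs, of set_mset] by (intro replicate_eqI) auto
  then show "xs = [a, a]" by simp
qed auto

text \<open>Common form of the four weight 3/2 generators and, over a one-element index set, of the
  two charged currents; their products then depend on pairwise inner products of exponents and on
  signs.\<close>

definition exp_sum :: "nat set \<Rightarrow> (nat \<Rightarrow> complex) \<Rightarrow> (nat \<Rightarrow> real^'n) \<Rightarrow> ('n::finite) state"
  where "exp_sum I a u = (\<Sum>i\<in>I. a i *\<^sub>C bstate {#} (u i))"

lemma products_eqI:
  assumes "\<And>n. mode \<epsilon> u (int n) v = (if n < length ws then ws ! n else 0)"
  shows "products \<epsilon> u v ws"
  using assms by (simp add: products_def)

lemma heis_exp_sum:
  "n > 0 \<Longrightarrow> heis i n (exp_sum I a u) = 0"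
  by (simp add: exp_sum_def heis_linear heis_bstate_empty_pos)

text \<open>Subtracting from a vector its orthogonal projections to the \<open>u i\<close> leaves a
  vector orthogonal to their span, hence to itself. Reading coordinate \<open>b\<close> of the
  resulting expansion of \<open>axis a 1\<close> gives the claim.\<close>

lemma orthogonal_basis_frame:
  fixes u :: "'i \<Rightarrow> real^'n::finite"
  assumes "finite I" "span (u ` I) = UNIV"
    and orth: "\<And>i j. i \<in> I \<Longrightarrow> j \<in> I \<Longrightarrow> u i \<bullet> u j = (if i = j then c else 0)" and "c \<noteq> 0"
  shows "(\<Sum>i\<in>I. u i $ a * u i $ b) = (if a = b then c else 0)"
proof -
  define y where "y x = x - (\<Sum>i\<in>I. ((u i \<bullet> x) / c) *\<^sub>R u i)" for x
  have y_orth: "u j \<bullet> y x = 0" if "j \<in> I" for j x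
  proof -
    have "u j \<bullet> (\<Sum>i\<in>I. ((u i \<bullet> x) / c) *\<^sub>R u i)
        = (\<Sum>i\<in>I. if i = j then u j \<bullet> x else 0)"
      unfolding inner_sum_right using orth[OF that] \<open>c \<noteq> 0\<close> by (intro sum.cong) auto
    also have "\<dots> = u j \<bullet> x" using that \<open>finite I\<close> by simp
    finally show ?thesis by (simp add: y_def inner_diff_right)
  qed
  have y_zero: "y x = 0" for x
  proof -
    have "y x \<in> span (u ` I)" using assms(2) by simp
    then have "orthogonal (y x) (y x)"
      by (rule orthogonal_to_span) (auto simp: orthogonal_def inner_commute[of "y x"] y_orth)
    then show ?thesis by (simp add: orthogonal_def)
  qed
  have "axis a 1 $ b = (\<Sum>i\<in>I. ((u i \<bullet> axis a 1) / c) *\<^sub>R u i) $ b"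
    using y_zero[of "axis a 1"] by (simp add: y_def)
  also have "\<dots> = (\<Sum>i\<in>I. u i $ a * u i $ b) / c"
    by (simp add: inner_axis sum_divide_distrib)
  finally show ?thesis using \<open>c \<noteq> 0\<close> by (auto simp: axis_def field_simps split: if_splits)
qed

section \<open>Weights of the states, and access to lists of products\<close>

lemma subspace_has_weight: "scale.subspace {v. has_weight v w}"
proof (rule scale.subspaceI)
  show "u + v \<in> {v. has_weight v w}" if "u \<in> {v. has_weight v w}" "v \<in> {v. has_weight v w}" for u v
    using that Poly_Mapping.keys_add[of u v] unfolding has_weight_def by blast
  show "c *\<^sub>C v \<in> {v. has_weight v w}" if "v \<in> {v. has_weight v w}" for c v
    using that by (simp add: has_weight_def in_keys_iff)
qed (simp add: has_weight_def)

lemma has_weight_exp_sum: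
  assumes "\<And>i. i \<in> I \<Longrightarrow> u i \<bullet> u i = 2 * w"
  shows "has_weight (exp_sum I a u) w"
proof -
  have "exp_sum I a u \<in> {v. has_weight v w}"
    unfolding exp_sum_def
    by (intro scale.subspace_sum scale.subspace_scale subspace_has_weight)
      (simp add: has_weight_def bstate_def weight_def assms)
  then show ?thesis by simp
qed

lemma has_weight_heis_vac: "has_weight (heis_vec \<alpha> (-1) vac) 1"
proof -
  have "heis_vec \<alpha> (-1) vac \<in> {v. has_weight v 1}"
    unfolding heis_vec_vac
    by (intro scale.subspace_sum scale.subspace_scale subspace_has_weight)
      (simp add: has_weight_def bstate_def weight_def)
  then show ?thesis by simp
qed

lemma products_nth: "products \<epsilon> u v ws \<Longrightarrow> n < length ws \<Longrightarrow> mode \<epsilon> u (int n) v = ws ! n"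
  by (simp add: products_def)

text \<open>Separates the use of a general product formula from the identification of its result
  with the prescribed list.\<close>

lemma products_cong: "products \<epsilon> u v ws \<Longrightarrow> ws = ws' \<Longrightarrow> products \<epsilon> u v ws'"
  by simp

lemma generated_subalgebra_halve:
  assumes "2 *\<^sub>C u \<in> generated_subalgebra \<epsilon> S"
  shows "u \<in> generated_subalgebra \<epsilon> S"
  using generated_subalgebra.scale[OF assms, of "1/2"] by simp

subsection \<open>Modes in the presence of a cocycle\<close>

locale lattice_cocycle =
  fixes L :: "(real^'n::finite) set" and \<epsilon> :: "real^'n \<Rightarrow> real^'n \<Rightarrow> complex"
  assumes cocycle: "is_cocycle L \<epsilon>"
    and zero_mem: "0 \<in> L"
    and add_mem: "\<alpha> \<in> L \<Longrightarrow> \<beta> \<in> L \<Longrightarrow> \<alpha> + \<beta> \<in> L"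
    and uminus_mem: "\<alpha> \<in> L \<Longrightarrow> - \<alpha> \<in> L"
begin

lemma eps_values: "\<alpha> \<in> L \<Longrightarrow> \<beta> \<in> L \<Longrightarrow> \<epsilon> \<alpha> \<beta> = 1 \<or> \<epsilon> \<alpha> \<beta> = -1"
  using cocycle unfolding is_cocycle_def by blast

lemma eps_add_left: "\<alpha> \<in> L \<Longrightarrow> \<beta> \<in> L \<Longrightarrow> \<gamma> \<in> L \<Longrightarrow> \<epsilon> (\<alpha> + \<beta>) \<gamma> = \<epsilon> \<alpha> \<gamma> * \<epsilon> \<beta> \<gamma>"
  and eps_add_right: "\<alpha> \<in> L \<Longrightarrow> \<beta> \<in> L \<Longrightarrow> \<gamma> \<in> L \<Longrightarrow> \<epsilon> \<alpha> (\<beta> + \<gamma>) = \<epsilon> \<alpha> \<beta> * \<epsilon> \<alpha> \<gamma>"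
  using cocycle unfolding is_cocycle_def by blast+

lemma eps_square: "\<alpha> \<in> L \<Longrightarrow> \<beta> \<in> L \<Longrightarrow> \<epsilon> \<alpha> \<beta> * \<epsilon> \<alpha> \<beta> = 1"
  using eps_values by fastforce

text \<open>Bimultiplicativity makes the value idempotent, and -1 is not.\<close>

lemma eps_zero_left: "\<beta> \<in> L \<Longrightarrow> \<epsilon> 0 \<beta> = 1"
  and eps_zero_right: "\<beta> \<in> L \<Longrightarrow> \<epsilon> \<beta> 0 = 1"
  using eps_add_left[of 0 0 \<beta>] eps_add_right[of \<beta> 0 0] eps_values[of 0 \<beta>] eps_values[of \<beta> 0]
  by (auto simp: zero_mem)

text \<open>The values at an element and at its negative multiply to 1, and signs are their own
  inverses.\<close>

lemma eps_minus_left: "\<alpha> \<in> L \<Longrightarrow> \<beta> \<in> L \<Longrightarrow> \<epsilon> (- \<alpha>) \<beta> = \<epsilon> \<alpha> \<beta>"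
  and eps_minus_right: "\<alpha> \<in> L \<Longrightarrow> \<beta> \<in> L \<Longrightarrow> \<epsilon> \<alpha> (- \<beta>) = \<epsilon> \<alpha> \<beta>"
  using eps_add_left[of \<alpha> "- \<alpha>" \<beta>] eps_add_right[of \<alpha> \<beta> "- \<beta>"] eps_values[of \<alpha> \<beta>]
    eps_values[of "- \<alpha>" \<beta>] eps_values[of \<alpha> "- \<beta>"]
  by (auto simp: uminus_mem eps_zero_left eps_zero_right)

lemma diff_mem: "\<alpha> \<in> L \<Longrightarrow> \<beta> \<in> L \<Longrightarrow> \<alpha> - \<beta> \<in> L"
  using add_mem[of \<alpha> "- \<beta>"] uminus_mem by simp

lemma eps_diff_left: "\<alpha> \<in> L \<Longrightarrow> \<beta> \<in> L \<Longrightarrow> \<gamma> \<in> L \<Longrightarrow> \<epsilon> (\<alpha> - \<beta>) \<gamma> = \<epsilon> \<alpha> \<gamma> * \<epsilon> \<beta> \<gamma>"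
  and eps_diff_right: "\<alpha> \<in> L \<Longrightarrow> \<beta> \<in> L \<Longrightarrow> \<gamma> \<in> L \<Longrightarrow> \<epsilon> \<alpha> (\<beta> - \<gamma>) = \<epsilon> \<alpha> \<beta> * \<epsilon> \<alpha> \<gamma>"
  using eps_add_left[of \<alpha> "- \<beta>" \<gamma>] eps_add_right[of \<alpha> \<beta> "- \<gamma>"]
  by (simp_all add: uminus_mem eps_minus_left eps_minus_right)

text \<open>The floors in \<open>is_cocycle\<close> become the given integers, and dividing by the
  sign \<open>\<epsilon> \<alpha> \<beta>\<close> is the same as multiplying by it.\<close>

lemma eps_swap:
  assumes "\<alpha> \<in> L" "\<beta> \<in> L" "\<alpha> \<bullet> \<beta> = of_int k" "\<alpha> \<bullet> \<alpha> = of_int m" "\<beta> \<bullet> \<beta> = of_int n"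
  shows "\<epsilon> \<beta> \<alpha> = (-1) powi (k + m * n) * \<epsilon> \<alpha> \<beta>"
proof -
  have "\<epsilon> \<alpha> \<beta> * \<epsilon> \<beta> \<alpha> = (-1) powi (k + m * n)"
    using cocycle assms unfolding is_cocycle_def by fastforce
  then show ?thesis using eps_values[OF assms(1,2)] by (auto simp: minus_equation_iff[of "\<epsilon> _ _"])
qed

lemma eps_self:
  assumes "\<alpha> \<in> L" "\<alpha> \<bullet> \<alpha> = of_int n"
  shows "\<epsilon> \<alpha> \<alpha> = (-1) powi ((n + n\<^sup>2) div 2)"
proof -
  have "\<epsilon> \<alpha> \<alpha> = (-1) powi ((\<lfloor>\<alpha> \<bullet> \<alpha>\<rfloor> + \<lfloor>\<alpha> \<bullet> \<alpha>\<rfloor>\<^sup>2) div 2)"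
    using cocycle assms(1) unfolding is_cocycle_def by blast
  then show ?thesis by (simp add: assms(2))
qed

text \<open>The vacuum gives the identity field: both exponentials of the zero vector are trivial
  and the power of z is 0, which singles out \<open>n = -1\<close>.\<close>

lemma exp_mode_zero:
  assumes "v \<in> lattice_sva L"
  shows "exp_mode \<epsilon> 0 n v = (if n = -1 then v else 0)"
proof -
  have 1: "exp_mode_basis \<epsilon> 0 n x = (if n = -1 then 1 else 0) *\<^sub>C (\<lambda>(m, \<beta>). bstate m \<beta>) x"
    if "x \<in> Poly_Mapping.keys v" for x
  proof -
    obtain m \<beta> where x [simp]: "x = (m, \<beta>)" by fastforce
    have "\<beta> \<in> L" using that assms by (force simp: lattice_sva_def)
    have "exp_mode_basis \<epsilon> 0 n x = exp_mode \<epsilon> 0 n (bstate m \<beta>)"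
      by (simp add: exp_mode_def)
    also have "\<dots> = (if n + 0 < 0 then \<epsilon> 0 \<beta> *\<^sub>C E_cr 0 (nat (- n - 1 - 0)) (bstate m (0 + \<beta>)) else 0)"
      by (rule exp_mode_bstate) (simp_all add: E_an_zero)
    finally show ?thesis
      using \<open>\<beta> \<in> L\<close> by (auto simp: E_cr_zero eps_zero_left)
  qed
  have "exp_mode \<epsilon> 0 n v
      = (if n = -1 then 1 else 0) *\<^sub>C lin_ext (\<lambda>(m, \<beta>). bstate m \<beta>) v"
    unfolding exp_mode_def lin_ext_def scale.scale_sum_right
    by (intro sum.cong refl) (subst 1, simp_all)
  then show ?thesis by (simp add: lin_ext_bstate_id)
qed

text \<open>The inner factor is the identity field, whose only nonzero mode has index -1;
  \<open>p - n - 1 = -1\<close> leaves the single index \<open>n = p\<close>.\<close>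

lemma monom_mode_singleton:
  assumes "v \<in> lattice_sva L"
  shows "monom_mode \<epsilon> [(i, 0)] 0 p v = heis i p v"
proof -
  define g where "g = (\<lambda>n::int. ((of_int (- n - 1) :: complex) gchoose 0) *\<^sub>C
         (if n < 0 then heis i n (monom_mode \<epsilon> [] 0 (p - n - int 0 - 1) v)
          else monom_mode \<epsilon> [] 0 (p - n - int 0 - 1) (heis i n v)))"
  have g: "g n = (if n = p then heis i p v else 0)" for n
    unfolding g_def using assms by (simp add: exp_mode_zero heis_mem heis_linear)
  have "monom_mode \<epsilon> [(i, 0)] 0 p v = Sum_any g"
    unfolding g_def by simp
  also have "\<dots> = sum g {p}"
    by (rule Sum_any.expand_superset) (auto simp: g split: if_splits)
  finally show ?thesis by (simp add: g)
qed

text \<open>Both derivative orders are 0, so the binomial factors are 1 and the normally ordered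
  square of h_i(z) remains.\<close>

lemma monom_mode_pair:
  assumes "v \<in> lattice_sva L"
  shows "monom_mode \<epsilon> [(i, 0), (i, 0)] 0 p v = Sum_any (\<lambda>n::int.
    if n < 0 then heis i n (heis i (p - n - 1) v) else heis i (p - n - 1) (heis i n v))"
proof -
  have "monom_mode \<epsilon> [(i, 0), (i, 0)] 0 p v = Sum_any (\<lambda>n::int.
      ((of_int (- n - 1) :: complex) gchoose 0) *\<^sub>C
         (if n < 0 then heis i n (monom_mode \<epsilon> [(i, 0)] 0 (p - n - int 0 - 1) v)
          else monom_mode \<epsilon> [(i, 0)] 0 (p - n - int 0 - 1) (heis i n v)))"
    by (simp only: monom_mode.simps(2) prod.case)
  then show ?thesis
    by (simp only: monom_mode_singleton[OF assms] monom_mode_singleton[OF heis_mem[OF assms]])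
      (simp cong: if_cong)
qed

lemma mode_heis_vec_vac:
  assumes "v \<in> lattice_sva L"
  shows "mode \<epsilon> (heis_vec \<alpha> (-1) vac) p v = heis_vec \<alpha> p v"
proof -
  have "mode \<epsilon> (bstate {#(i, 0)#} 0) p v = heis i p v" for i
    unfolding mode_def lin_ext_bstate prod.case mset_eq_singleton
    by (simp only: some_eq_trivial monom_mode_singleton[OF assms])
  then show ?thesis
    by (simp only: heis_vec_vac module_hom.sum[OF linear_mode_left]
        module_hom.scale[OF linear_mode_left]) (simp add: heis_vec_def)
qed

lemma mode_lattice_virasoro:
  assumes "v \<in> lattice_sva L"
  shows "mode \<epsilon> lattice_virasoro p v = (1/2) *\<^sub>C (\<Sum>i\<in>UNIV. Sum_any (\<lambda>n::int.
    if n < 0 then heis i n (heis i (p - n - 1) v) else heis i (p - n - 1) (heis i n v)))"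
proof -
  have "mode \<epsilon> (bstate {#(i, 0), (i, 0)#} 0) p v = Sum_any (\<lambda>n::int.
    if n < 0 then heis i n (heis i (p - n - 1) v) else heis i (p - n - 1) (heis i n v))" for i
    unfolding mode_def lin_ext_bstate prod.case mset_eq_pair_same
    by (simp only: some_eq_trivial monom_mode_pair[OF assms])
  then show ?thesis
    by (simp add: lattice_virasoro_eq module_hom.sum[OF linear_mode_left]
        module_hom.scale[OF linear_mode_left])
qed

text \<open>
  The summand is nonzero only at \<open>n = n0\<close> and, if this index is negative, at \<open>n = p - n0 - 1\<close>;
  both contribute the same vector.
\<close>

lemma mode_lattice_virasoro_nonneg:
  assumes "v \<in> lattice_sva L" "p \<ge> 0" "n0 \<ge> 0" and van: "\<And>i n. n \<ge> 0 \<Longrightarrow> n \<noteq> n0 \<Longrightarrow> heis i n v = 0"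
  shows "mode \<epsilon> lattice_virasoro p v = (if p \<le> n0 then 1 else 1/2) *\<^sub>C
    (\<Sum>i\<in>UNIV. heis i (p - n0 - 1) (heis i n0 v))"
proof -
  have "Sum_any (\<lambda>n::int. if n < 0 then heis i n (heis i (p - n - 1) v)
      else heis i (p - n - 1) (heis i n v)) =
    (if p \<le> n0 then 2 else 1) *\<^sub>C heis i (p - n0 - 1) (heis i n0 v)" for i
  proof -
    define g where "g = (\<lambda>n::int. if n < 0 then heis i n (heis i (p - n - 1) v)
      else heis i (p - n - 1) (heis i n v))"
    have "g n = 0" if "n \<noteq> n0" "n \<noteq> p - n0 - 1 \<or> p > n0" for n
      using that assms(2,3) by (auto simp: g_def van heis_linear)
    then have "Sum_any g = sum g (if p \<le> n0 then {n0, p - n0 - 1} else {n0})"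
      by (intro Sum_any.expand_superset) (auto split: if_splits, (meson not_le)+)
    also have "\<dots> = (if p \<le> n0 then 2 else 1) *\<^sub>C heis i (p - n0 - 1) (heis i n0 v)"
      using assms(2,3) scale.scale_left_distrib[of 1 1 "heis i (p - n0 - 1) (heis i n0 v)"]
      by (auto simp: g_def)
    finally show ?thesis by (simp add: g_def)
  qed
  then show ?thesis
    by (simp add: mode_lattice_virasoro assms(1) scale.scale_sum_right)
qed

subsection \<open>Products of sums of exponentials\<close>

lemma exp_sum_mem:
  assumes "\<And>i. i \<in> I \<Longrightarrow> u i \<in> L"
  shows "exp_sum I a u \<in> lattice_sva L"
  unfolding exp_sum_def
  by (intro scale.subspace_sum scale.subspace_scale subspace_lattice_sva) (simp add: assms)

lemma mode_exp_sum:
  "mode \<epsilon> (exp_sum I a u) p v = (\<Sum>i\<in>I. a i *\<^sub>C exp_mode \<epsilon> (u i) p v)"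
  by (simp add: exp_sum_def module_hom.sum[OF linear_mode_left]
      module_hom.scale[OF linear_mode_left] mode_bstate_empty)

lemma mode_exp_sum_exp_sum:
  "mode \<epsilon> (exp_sum I a u) p (exp_sum J b v)
    = (\<Sum>i\<in>I. \<Sum>j\<in>J. (a i * b j) *\<^sub>C exp_mode \<epsilon> (u i) p (bstate {#} (v j)))"
  by (simp add: mode_exp_sum) (simp add: exp_sum_def module_hom.sum[OF linear_exp_mode]
      module_hom.scale[OF linear_exp_mode] scale.scale_sum_right)

text \<open>The powers of z start at \<open>\<alpha> \<bullet> \<beta>\<close>, so a nonnegative
  integer there leaves no pole.\<close>

lemma exp_mode_nonneg_vanish:
  assumes "\<alpha> \<bullet> \<beta> \<in> \<nat>" "p \<ge> 0"
  shows "exp_mode \<epsilon> \<alpha> p (bstate {#} \<beta>) = 0"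
proof -
  obtain k where "\<alpha> \<bullet> \<beta> = of_int (int k)" using assms(1) by (auto simp: Nats_def)
  then show ?thesis using assms(2) by (simp add: exp_mode_bstate_empty[of _ _ "int k"])
qed

lemma products_exp_sum_zero:
  assumes "\<And>i j. i \<in> I \<Longrightarrow> j \<in> J \<Longrightarrow> u i \<bullet> v j \<in> \<nat>"
  shows "products \<epsilon> (exp_sum I a u) (exp_sum J b v) []"
  by (rule products_eqI)
    (simp add: mode_exp_sum_exp_sum exp_mode_nonneg_vanish assms)

lemma mode_exp_sum_diagonal:
  assumes "finite I" "p \<ge> 0" and off: "\<And>i j. i \<in> I \<Longrightarrow> j \<in> I \<Longrightarrow> i \<noteq> j \<Longrightarrow> u i \<bullet> v j \<in> \<nat>"
  shows "mode \<epsilon> (exp_sum I a u) p (exp_sum I b v)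
    = (\<Sum>i\<in>I. (a i * b i) *\<^sub>C exp_mode \<epsilon> (u i) p (bstate {#} (v i)))"
  unfolding mode_exp_sum_exp_sum
proof (rule sum.cong[OF refl])
  fix i assume "i \<in> I"
  have "(\<Sum>j\<in>I. (a i * b j) *\<^sub>C exp_mode \<epsilon> (u i) p (bstate {#} (v j)))
      = (\<Sum>j\<in>{i}. (a i * b j) *\<^sub>C exp_mode \<epsilon> (u i) p (bstate {#} (v j)))"
    using \<open>i \<in> I\<close> assms(1,2)
    by (intro sum.mono_neutral_right) (auto simp: exp_mode_nonneg_vanish off)
  then show "(\<Sum>j\<in>I. (a i * b j) *\<^sub>C exp_mode \<epsilon> (u i) p (bstate {#} (v j)))
      = (a i * b i) *\<^sub>C exp_mode \<epsilon> (u i) p (bstate {#} (v i))" by simp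
qed

text \<open>Simple poles: only the constant term of the creation exponential reaches a nonnegative
  mode.\<close>

lemma products_exp_sum_contract:
  assumes "\<And>j. j \<in> J \<Longrightarrow> u \<bullet> v j = -1"
  shows "products \<epsilon> (c *\<^sub>C bstate {#} u) (exp_sum J b v)
    [exp_sum J (\<lambda>j. c * b j * \<epsilon> u (v j)) (\<lambda>j. u + v j)]"
proof (rule products_eqI)
  fix n :: nat
  have "exp_mode \<epsilon> u (int n) (bstate {#} (v j))
      = (if n = 0 then \<epsilon> u (v j) *\<^sub>C bstate {#} (u + v j) else 0)" if "j \<in> J" for j
    by (subst exp_mode_bstate_empty[of _ _ "-1"]) (auto simp: assms that E_cr_0)
  then show "mode \<epsilon> (c *\<^sub>C bstate {#} u) (int n) (exp_sum J b v)
      = (if n < length [exp_sum J (\<lambda>j. c * b j * \<epsilon> u (v j)) (\<lambda>j. u + v j)]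
         then [exp_sum J (\<lambda>j. c * b j * \<epsilon> u (v j)) (\<lambda>j. u + v j)] ! n else 0)"
    by (simp add: module_hom.scale[OF linear_mode_left] mode_bstate_empty exp_sum_def
        module_hom.sum[OF linear_exp_mode] module_hom.scale[OF linear_exp_mode]
        scale.scale_sum_right mult.assoc)
qed

text \<open>Double poles on the diagonal only: mode \<open>n\<close> picks degree
  \<open>1 - n\<close> of the creation exponential. As \<open>c\<close> and \<open>\<gamma>\<close>
  do not depend on \<open>i\<close>, the linear terms add up to the Heisenberg mode of the sum of
  all exponents.\<close>

lemma products_exp_sum_minus2:
  assumes "finite I" "\<And>i j. i \<in> I \<Longrightarrow> j \<in> I \<Longrightarrow> i \<noteq> j \<Longrightarrow> u i \<bullet> v j \<in> \<nat>"
    and "\<And>i. i \<in> I \<Longrightarrow> u i \<bullet> v i = -2"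
    and "\<And>i. i \<in> I \<Longrightarrow> u i + v i = \<gamma>"
    and "\<And>i. i \<in> I \<Longrightarrow> a i * b i * \<epsilon> (u i) (v i) = c"
  shows "products \<epsilon> (exp_sum I a u) (exp_sum I b v)
    [c *\<^sub>C heis_vec (\<Sum>i\<in>I. u i) (-1) (bstate {#} \<gamma>), (c * of_nat (card I)) *\<^sub>C bstate {#} \<gamma>]"
proof (rule products_eqI)
  fix n :: nat
  have "(a i * b i) *\<^sub>C exp_mode \<epsilon> (u i) (int n) (bstate {#} (v i))
      = (if n = 0 then c *\<^sub>C heis_vec (u i) (-1) (bstate {#} \<gamma>)
         else if n = 1 then c *\<^sub>C bstate {#} \<gamma> else 0)" if "i \<in> I" for i
    by (subst exp_mode_bstate_empty[of _ _ "-2"])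
      (auto simp: assms(3-4) that E_cr_0 E_cr_1 assms(5)[OF that, symmetric])
  then have "mode \<epsilon> (exp_sum I a u) (int n) (exp_sum I b v)
      = (\<Sum>i\<in>I. if n = 0 then c *\<^sub>C heis_vec (u i) (-1) (bstate {#} \<gamma>)
         else if n = 1 then c *\<^sub>C bstate {#} \<gamma> else 0)"
    by (simp add: mode_exp_sum_diagonal assms(1,2))
  also have "\<dots> = (if n = 0 then c *\<^sub>C heis_vec (\<Sum>i\<in>I. u i) (-1) (bstate {#} \<gamma>)
         else if n = 1 then (c * of_nat (card I)) *\<^sub>C bstate {#} \<gamma> else 0)"
    by (auto simp: heis_vec_sum scale.scale_sum_right scale.sum_constant_scale mult.commute simp del: sum_constant)
  finally show "mode \<epsilon> (exp_sum I a u) (int n) (exp_sum I b v) =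
    (if n < length [c *\<^sub>C heis_vec (\<Sum>i\<in>I. u i) (-1) (bstate {#} \<gamma>), (c * of_nat (card I)) *\<^sub>C bstate {#} \<gamma>]
     then [c *\<^sub>C heis_vec (\<Sum>i\<in>I. u i) (-1) (bstate {#} \<gamma>), (c * of_nat (card I)) *\<^sub>C bstate {#} \<gamma>] ! n else 0)"
    by (simp add: nth_Cons split: nat.split)
qed

text \<open>Triple poles on the diagonal only: mode \<open>n\<close> picks degree
  \<open>2 - n\<close>, and degree two is what brings in the squares that build a Virasoro
  vector.\<close>

lemma products_exp_sum_minus3:
  assumes "finite I" "\<And>i j. i \<in> I \<Longrightarrow> j \<in> I \<Longrightarrow> i \<noteq> j \<Longrightarrow> u i \<bullet> v j \<in> \<nat>"
    and "\<And>i. i \<in> I \<Longrightarrow> u i \<bullet> v i = -3"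
    and "\<And>i. i \<in> I \<Longrightarrow> u i + v i = 0"
    and "\<And>i. i \<in> I \<Longrightarrow> a i * b i * \<epsilon> (u i) (v i) = c"
  shows "products \<epsilon> (exp_sum I a u) (exp_sum I b v)
    [(c / 2) *\<^sub>C ((\<Sum>i\<in>I. heis_vec (u i) (-1) (heis_vec (u i) (-1) vac)) + heis_vec (\<Sum>i\<in>I. u i) (-2) vac),
     c *\<^sub>C heis_vec (\<Sum>i\<in>I. u i) (-1) vac, (c * of_nat (card I)) *\<^sub>C vac]" (is "products _ _ _ ?ws")
proof (rule products_eqI)
  fix n :: nat
  let ?f = "\<lambda>i. if n = 0 then (c / 2) *\<^sub>C (heis_vec (u i) (-1) (heis_vec (u i) (-1) vac) + heis_vec (u i) (-2) vac)
         else if n = 1 then c *\<^sub>C heis_vec (u i) (-1) vac else if n = 2 then c *\<^sub>C vac else 0"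
  have "(a i * b i) *\<^sub>C exp_mode \<epsilon> (u i) (int n) (bstate {#} (v i)) = ?f i" if "i \<in> I" for i
  proof -
    \<comment> \<open>Reduces the degree to 2, 1 or 0, where the coefficients are known; for
      \<open>n > 2\<close> the mode vanishes.\<close>
    have "nat (2 - int n) = 2 - n" by simp
    moreover have "n = 0 \<or> n = 1 \<or> n = 2 \<or> n > 2" by linarith
    ultimately show ?thesis
      by (subst exp_mode_bstate_empty[of _ _ "-3"])
        (auto simp: assms(3-4) that E_cr_0 E_cr_1 E_cr_2 assms(5)[OF that, symmetric] vac_def
          numeral_2_eq_2)
  qed
  then have "mode \<epsilon> (exp_sum I a u) (int n) (exp_sum I b v) = (\<Sum>i\<in>I. ?f i)"
    by (simp add: mode_exp_sum_diagonal assms(1,2))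
  also have "\<dots> = (if n = 0 then ?ws ! 0 else if n = 1 then ?ws ! 1 else if n = 2 then ?ws ! 2 else 0)"
    by (auto simp: heis_vec_sum scale.scale_sum_right[symmetric] sum.distrib[symmetric]
        scale.sum_constant_scale mult.commute simp del: sum_constant)
  finally show "mode \<epsilon> (exp_sum I a u) (int n) (exp_sum I b v) =
    (if n < length ?ws then ?ws ! n else 0)"
    by (auto simp: less_Suc_eq numeral_2_eq_2)
qed

text \<open>Simple poles off the diagonal do not vanish one by one, but the terms for (i, j) and (j,
  i) are opposite multiples of the same exponential. The double sum thus equals its own
  negative.\<close>

lemma products_exp_sum_antisym:
  assumes "\<And>i. i \<in> I \<Longrightarrow> u i \<bullet> v i \<in> \<nat>"
    and "\<And>i j. i \<in> I \<Longrightarrow> j \<in> I \<Longrightarrow> i \<noteq> j \<Longrightarrow> u i \<bullet> v j = -1"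
    and "\<And>i j. i \<in> I \<Longrightarrow> j \<in> I \<Longrightarrow> i \<noteq> j \<Longrightarrow> u i + v j = u j + v i"
    and "\<And>i j. i \<in> I \<Longrightarrow> j \<in> I \<Longrightarrow> i \<noteq> j \<Longrightarrow>
      a i * b j * \<epsilon> (u i) (v j) = - (a j * b i * \<epsilon> (u j) (v i))"
  shows "products \<epsilon> (exp_sum I a u) (exp_sum I b v) []"
proof (rule products_eqI)
  fix n :: nat
  define g where "g i j = (a i * b j) *\<^sub>C exp_mode \<epsilon> (u i) (int n) (bstate {#} (v j))" for i j
  have g: "g i j = (if n = 0 then (a i * b j * \<epsilon> (u i) (v j)) *\<^sub>C bstate {#} (u i + v j) else 0)"
    if "i \<in> I" "j \<in> I" "i \<noteq> j" for i j
    unfolding g_def by (subst exp_mode_bstate_empty[of _ _ "-1"]) (auto simp: assms(2) that E_cr_0)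
  have anti: "g i j = - g j i" if "i \<in> I" "j \<in> I" for i j
  proof (cases "i = j")
    case True
    then show ?thesis using that by (simp add: g_def exp_mode_nonneg_vanish assms(1))
  next
    case False
    have "g i j = (if n = 0 then (- (a j * b i * \<epsilon> (u j) (v i))) *\<^sub>C bstate {#} (u j + v i) else 0)"
      unfolding g[OF that False] assms(3)[OF that False] assms(4)[OF that False] ..
    also have "\<dots> = - g j i" using g[OF that(2,1)] False by auto
    finally show ?thesis .
  qed
  have "(\<Sum>i\<in>I. \<Sum>j\<in>I. g i j) = (\<Sum>i\<in>I. \<Sum>j\<in>I. - g j i)"
    by (intro sum.cong refl anti)
  also have "\<dots> = - (\<Sum>i\<in>I. \<Sum>j\<in>I. g i j)"
    by (simp add: sum_negf) (rule sum.swap)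
  finally have "(\<Sum>i\<in>I. \<Sum>j\<in>I. g i j) = 0"
    by (simp add: poly_mapping_eq_iff fun_eq_iff)
  then show "mode \<epsilon> (exp_sum I a u) (int n) (exp_sum I b v)
      = (if n < length [] then [] ! n else 0)"
    by (simp add: mode_exp_sum_exp_sum g_def)
qed

lemma products_charge_exp_sum:
  assumes "\<And>i. i \<in> I \<Longrightarrow> u i \<in> L" "\<And>i. i \<in> I \<Longrightarrow> \<alpha> \<bullet> u i = c"
  shows "products \<epsilon> (heis_vec \<alpha> (-1) vac) (exp_sum I a u) [complex_of_real c *\<^sub>C exp_sum I a u]"
proof (rule products_eqI)
  fix n :: nat
  have "heis_vec \<alpha> (int n) (exp_sum I a u) = (if n = 0 then complex_of_real c *\<^sub>C exp_sum I a u else 0)"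
    by (auto simp: exp_sum_def heis_vec_linear heis_vec_bstate_empty_pos heis_vec_zero_bstate
        assms(2) scale.scale_sum_right mult.commute intro!: sum.cong)
  then show "mode \<epsilon> (heis_vec \<alpha> (-1) vac) (int n) (exp_sum I a u) =
    (if n < length [complex_of_real c *\<^sub>C exp_sum I a u] then [complex_of_real c *\<^sub>C exp_sum I a u] ! n else 0)"
    by (simp add: mode_heis_vec_vac exp_sum_mem assms(1))
qed

section \<open>Heisenberg currents, translates and the Virasoro vector\<close>

lemma vac_mem: "vac \<in> lattice_sva L"
  by (simp add: vac_def zero_mem)

lemma products_heis_heis:
  "products \<epsilon> (heis_vec \<alpha> (-1) vac) (heis_vec \<beta> (-1) vac) [0, complex_of_real (\<alpha> \<bullet> \<beta>) *\<^sub>C vac]"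
proof (rule products_eqI)
  fix n :: nat
  have "heis_vec \<alpha> (int n) (heis_vec \<beta> (-1) vac) = (if n = 1 then complex_of_real (\<alpha> \<bullet> \<beta>) *\<^sub>C vac else 0)"
    by (simp add: heis_vec_def[of \<alpha>] heis_heis_vec_vac inner_vec_def scale.scale_sum_left)
  then show "mode \<epsilon> (heis_vec \<alpha> (-1) vac) (int n) (heis_vec \<beta> (-1) vac) =
    (if n < length [0, complex_of_real (\<alpha> \<bullet> \<beta>) *\<^sub>C vac] then [0, complex_of_real (\<alpha> \<bullet> \<beta>) *\<^sub>C vac] ! n else 0)"
    by (auto simp: mode_heis_vec_vac heis_vec_mem vac_mem less_Suc_eq nth_Cons split: nat.split)
qed

lemma transl_heis: "transl \<epsilon> (heis_vec \<alpha> (-1) vac) = heis_vec \<alpha> (-2) vac"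
  by (simp add: transl_def mode_heis_vec_vac vac_mem)

lemma transl_exp_sum:
  assumes "\<And>i. i \<in> I \<Longrightarrow> u i \<in> L"
  shows "transl \<epsilon> (exp_sum I a u) = (\<Sum>i\<in>I. a i *\<^sub>C heis_vec (u i) (-1) (bstate {#} (u i)))"
  unfolding transl_def mode_exp_sum vac_def
  by (intro sum.cong refl, subst exp_mode_bstate_empty[of _ _ 0])
    (simp_all add: assms eps_zero_right E_cr_1)

lemma transl_exp:
  assumes "\<alpha> \<in> L"
  shows "transl \<epsilon> (c *\<^sub>C bstate {#} \<alpha>) = c *\<^sub>C heis_vec \<alpha> (-1) (bstate {#} \<alpha>)"
  using transl_exp_sum[of "{0}" "\<lambda>_. \<alpha>" "\<lambda>_. c"] assms by (simp add: exp_sum_def)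

text \<open>The indices \<open>n = -1\<close> and \<open>n = -2\<close> give the same monomial,
  which cancels the factor 1/2; any other index puts an annihilation operator on the vacuum.\<close>

lemma transl_lattice_virasoro:
  "transl \<epsilon> lattice_virasoro = (\<Sum>i\<in>UNIV. heis i (-2) (heis i (-1) vac))"
proof -
  have "Sum_any (\<lambda>n::int. if n < 0 then heis i n (heis i (-2 - n - 1) vac)
      else heis i (-2 - n - 1) (heis i n vac)) = 2 *\<^sub>C heis i (-2) (heis i (-1) vac)" for i :: 'n
  proof -
    define g where "g = (\<lambda>n::int. if n < 0 then heis i n (heis i (-2 - n - 1) vac)
      else heis i (-2 - n - 1) (heis i n vac))"
    have "g n = 0" if "n \<noteq> -1" "n \<noteq> -2" for n
      using that by (auto simp: g_def heis_vac heis_linear)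
    then have "Sum_any g = sum g {-1, -2}"
      by (intro Sum_any.expand_superset) auto
    also have "\<dots> = heis i (-1) (heis i (-2) vac) + heis i (-2) (heis i (-1) vac)"
      by (simp add: g_def)
    also have "heis i (-1) (heis i (-2) vac) = heis i (-2) (heis i (-1) vac)"
      by (simp add: vac_def heis_bstate heis_basis_def add_mset_commute)
    finally show ?thesis
      using scale.scale_left_distrib[of 1 1 "heis i (-2) (heis i (-1) vac)"] by (simp add: g_def)
  qed
  then show ?thesis
    by (simp add: transl_def mode_lattice_virasoro vac_mem scale.scale_sum_right)
qed

lemma lattice_virasoro_mem: "lattice_virasoro \<in> lattice_sva L"
  unfolding lattice_virasoro_def
  by (intro scale.subspace_sum scale.subspace_scale subspace_lattice_sva heis_mem vac_mem)

lemma primary_heis: "primary \<epsilon> lattice_virasoro 1 (heis_vec \<alpha> (-1) vac)"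
  unfolding primary_def transl_heis
proof (rule products_eqI)
  fix n :: nat
  have v: "heis_vec \<alpha> (-1) vac \<in> lattice_sva L" by (simp add: heis_vec_mem vac_mem)
  \<comment> \<open>Taken with \<open>n0 = 1\<close>: of the nonnegative Heisenberg modes only
    h_i(1) can act nontrivially here.\<close>
  have "mode \<epsilon> lattice_virasoro (int n) (heis_vec \<alpha> (-1) vac) = (if int n \<le> 1 then 1 else 1/2) *\<^sub>C
    (\<Sum>i\<in>UNIV. heis i (int n - 1 - 1) (heis i 1 (heis_vec \<alpha> (-1) vac)))"
    by (rule mode_lattice_virasoro_nonneg) (simp_all add: v heis_heis_vec_vac)
  also have "\<dots> = (if n \<le> 1 then 1 else 1/2) *\<^sub>C heis_vec \<alpha> (int n - 2) vac"
    by (simp add: heis_heis_vec_vac heis_linear) (simp add: heis_vec_def)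
  also have "\<dots> = (if n = 0 then heis_vec \<alpha> (-2) vac else if n = 1 then heis_vec \<alpha> (-1) vac else 0)"
    by (auto simp: heis_vec_vac_nonneg)
  finally show "mode \<epsilon> lattice_virasoro (int n) (heis_vec \<alpha> (-1) vac) =
    (if n < length [heis_vec \<alpha> (-2) vac, 1 *\<^sub>C heis_vec \<alpha> (-1) vac]
     then [heis_vec \<alpha> (-2) vac, 1 *\<^sub>C heis_vec \<alpha> (-1) vac] ! n else 0)"
    by (auto simp: less_Suc_eq nth_Cons split: nat.split)
qed

lemma primary_exp_sum:
  assumes "\<And>i. i \<in> I \<Longrightarrow> u i \<in> L" "\<And>i. i \<in> I \<Longrightarrow> u i \<bullet> u i = 2 * r"
  shows "primary \<epsilon> lattice_virasoro (complex_of_real r) (exp_sum I a u)"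
  unfolding primary_def
proof (rule products_eqI)
  fix n :: nat
  define T where "T = transl \<epsilon> (exp_sum I a u)"
  \<comment> \<open>Taken with \<open>n0 = 0\<close>, since positive Heisenberg modes kill
    exponentials. At \<open>n = 1\<close> the factor 1/2 then turns \<open>u i \<bullet> u i\<close>
    into the weight \<open>r\<close>.\<close>
  have "mode \<epsilon> lattice_virasoro (int n) (exp_sum I a u) = (if int n \<le> 0 then 1 else 1/2) *\<^sub>C
    (\<Sum>k\<in>UNIV. heis k (int n - 0 - 1) (heis k 0 (exp_sum I a u)))"
    by (rule mode_lattice_virasoro_nonneg) (simp_all add: exp_sum_mem assms heis_exp_sum)
  also have "(\<Sum>k\<in>UNIV. heis k (int n - 0 - 1) (heis k 0 (exp_sum I a u)))
      = (\<Sum>k\<in>UNIV. \<Sum>i\<in>I. (a i * complex_of_real (u i $ k)) *\<^sub>C heis k (int n - 1) (bstate {#} (u i)))"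
    by (simp add: exp_sum_def heis_linear heis_zero_bstate)
  also have "\<dots> = (\<Sum>i\<in>I. \<Sum>k\<in>UNIV. (a i * complex_of_real (u i $ k)) *\<^sub>C heis k (int n - 1) (bstate {#} (u i)))"
    by (rule sum.swap)
  also have "\<dots> = (\<Sum>i\<in>I. a i *\<^sub>C heis_vec (u i) (int n - 1) (bstate {#} (u i)))"
    by (simp add: heis_vec_def scale.scale_sum_right)
  also have "(if int n \<le> 0 then 1 else 1/2) *\<^sub>C \<dots> = (if n = 0 then T
      else if n = 1 then complex_of_real r *\<^sub>C exp_sum I a u else 0)"
  proof -
    consider "n = 0" | "n = 1" | "n > 1" by linarith
    then show ?thesis
    proof cases
      case 2
      then show ?thesis
        by (auto simp: heis_vec_zero_bstate assms(2) exp_sum_def scale.scale_sum_right mult_ac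
            intro!: sum.cong)
    qed (simp_all add: T_def transl_exp_sum assms(1) heis_vec_bstate_empty_pos)
  qed
  finally show "mode \<epsilon> lattice_virasoro (int n) (exp_sum I a u) =
    (if n < length [transl \<epsilon> (exp_sum I a u), complex_of_real r *\<^sub>C exp_sum I a u]
     then [transl \<epsilon> (exp_sum I a u), complex_of_real r *\<^sub>C exp_sum I a u] ! n else 0)"
    by (auto simp: less_Suc_eq nth_Cons T_def split: nat.split)
qed

text \<open>At \<open>n = 3\<close> each coordinate contributes h_i(1)h_i(-1) on the vacuum, that is
  one vacuum, with factor 1/2; hence the central charge is the dimension.\<close>

lemma virasoro_lattice_virasoro:
  "virasoro_element \<epsilon> (of_nat CARD('n)) lattice_virasoro"
  unfolding virasoro_element_def transl_lattice_virasoro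
proof (rule products_eqI)
  fix n :: nat
  let ?ws = "[\<Sum>i\<in>UNIV. heis i (- 2) (heis i (- 1) vac), 2 *\<^sub>C lattice_virasoro, 0,
     (of_nat CARD('n) / 2) *\<^sub>C (vac :: 'n state)]"
  have "mode \<epsilon> lattice_virasoro (int n) lattice_virasoro = (if int n \<le> 1 then 1 else 1/2) *\<^sub>C
    (\<Sum>i\<in>UNIV. heis i (int n - 1 - 1) (heis i 1 lattice_virasoro))"
    by (rule mode_lattice_virasoro_nonneg) (simp_all add: lattice_virasoro_mem heis_lattice_virasoro)
  also have "\<dots> = (if n \<le> 1 then 1 else 1/2) *\<^sub>C (\<Sum>i\<in>UNIV. heis i (int n - 2) (heis i (-1) vac))"
    by (simp add: heis_lattice_virasoro)
  also have "\<dots> = (if n < length ?ws then ?ws ! n else 0)"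
  proof -
    consider "n = 0" | "n = 1" | "n = 2" | "n = 3" | "n > 3" by linarith
    then show ?thesis
      by cases (simp_all add: lattice_virasoro_def heis_heis_vac scale.sum_constant_scale del: sum_constant)
  qed
  finally show "mode \<epsilon> lattice_virasoro (int n) lattice_virasoro = (if n < length ?ws then ?ws ! n else 0)" .
qed

end

subsection \<open>The superconformal generators\<close>

theorem proposition26:
  fixes \<alpha> :: "nat \<Rightarrow> real^6" and h :: "real^6" and L :: "(real^6) set"
    and \<epsilon> :: "real^6 \<Rightarrow> real^6 \<Rightarrow> complex"
  assumes basis: "independent (\<alpha> ` {1..6})" "span (\<alpha> ` {1..6}) = UNIV"
    and orthogonal: "\<And>i j. i \<in> {1..6} \<Longrightarrow> j \<in> {1..6} \<Longrightarrow> i \<noteq> j \<Longrightarrow> \<alpha> i \<bullet> \<alpha> j = 0"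
    and norm3: "\<And>i. i \<in> {1..6} \<Longrightarrow> \<alpha> i \<bullet> \<alpha> i = 3"
    and h: "h = (1/3) *\<^sub>R (\<Sum>i=1..6. \<alpha> i)"
    and L: "L = {(\<Sum>i=1..6. of_int (a i) *\<^sub>R \<alpha> i) + of_int b *\<^sub>R h | (a :: nat \<Rightarrow> int) (b :: int). True}"
    and cocycle: "is_cocycle L \<epsilon>"
  shows "\<exists>A. N4_subalgebra L \<epsilon> 6 lattice_virasoro A"
proof -

  \<comment> \<open>Inner products of the \<alpha>_i and h\<close>
  define I :: "nat set" where "I = {1..6}"
  have I [simp]: "finite I" "card I = 6" by (simp_all add: I_def)
  have \<alpha>\<alpha>: "\<alpha> i \<bullet> \<alpha> j = (if i = j then 3 else 0)" if "i \<in> I" "j \<in> I" for i j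
    using that orthogonal norm3 by (auto simp: I_def)
  have sum_\<alpha>: "(\<Sum>i\<in>I. \<alpha> i) = 3 *\<^sub>R h"
    by (simp add: h I_def)
  have \<alpha>h: "\<alpha> i \<bullet> h = 1" if "i \<in> I" for i
  proof -
    have "3 * (\<alpha> i \<bullet> h) = (\<Sum>j\<in>I. \<alpha> i \<bullet> \<alpha> j)"
      using arg_cong[OF sum_\<alpha>, of "\<lambda>x. \<alpha> i \<bullet> x"] by (simp add: inner_sum_right)
    also have "\<dots> = (\<Sum>j\<in>I. if i = j then 3 else 0)"
      using that by (intro sum.cong) (auto simp: \<alpha>\<alpha>)
    finally show ?thesis using that by simp
  qed
  have h\<alpha>: "h \<bullet> \<alpha> i = 1" if "i \<in> I" for i
    using \<alpha>h[OF that] by (simp add: inner_commute)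
  have hh: "h \<bullet> h = 2"
    using arg_cong[OF sum_\<alpha>, of "\<lambda>x. x \<bullet> h"] by (simp add: inner_sum_left \<alpha>h)
  note inner_values = \<alpha>\<alpha> \<alpha>h h\<alpha> hh inner_diff_left inner_diff_right

  \<comment> \<open>The lattice as an additive group\<close>
  have L_mem: "(\<Sum>i=1..6. of_int (a i) *\<^sub>R \<alpha> i) + of_int b *\<^sub>R h \<in> L" for a b
    unfolding L by blast
  interpret lattice_cocycle L \<epsilon>
  proof
    show "0 \<in> L" using L_mem[of "\<lambda>_. 0" 0] by simp
    show "x + y \<in> L" if xy: "x \<in> L" "y \<in> L" for x y
    proof -
      obtain a b where x: "x = (\<Sum>i=1..6. of_int (a i) *\<^sub>R \<alpha> i) + of_int b *\<^sub>R h"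
        using xy(1) unfolding L by blast
      obtain a' b' where y: "y = (\<Sum>i=1..6. of_int (a' i) *\<^sub>R \<alpha> i) + of_int b' *\<^sub>R h"
        using xy(2) unfolding L by blast
      have "x + y = (\<Sum>i=1..6. of_int (a i + a' i) *\<^sub>R \<alpha> i) + of_int (b + b') *\<^sub>R h"
        by (simp add: x y scaleR_left_distrib sum.distrib)
      then show ?thesis by (simp only: L_mem)
    qed
    show "- x \<in> L" if xL: "x \<in> L" for x
    proof -
      obtain a b where x: "x = (\<Sum>i=1..6. of_int (a i) *\<^sub>R \<alpha> i) + of_int b *\<^sub>R h"
        using xL unfolding L by blast
      have "- x = (\<Sum>i=1..6. of_int (- a i) *\<^sub>R \<alpha> i) + of_int (- b) *\<^sub>R h"
        by (simp add: x sum_negf)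
      then show ?thesis by (simp only: L_mem)
    qed
  qed (rule cocycle)
  have h_mem: "h \<in> L" using L_mem[of "\<lambda>_. 0" 1] by simp
  have \<alpha>_mem: "\<alpha> i \<in> L" if "i \<in> I" for i
  proof -
    have "(\<Sum>j=1..6. of_int (if j = i then 1 else 0) *\<^sub>R \<alpha> j) = (\<Sum>j=1..6. if j = i then \<alpha> j else 0)"
      by (intro sum.cong) auto
    also have "\<dots> = \<alpha> i" using that by (simp add: I_def)
    finally show ?thesis using L_mem[of "\<lambda>j. if j = i then 1 else 0" 0] by simp
  qed
  note mem = h_mem \<alpha>_mem uminus_mem diff_mem

  \<comment> \<open>Signs of the cocycle\<close>
  define s where "s i = \<epsilon> h (\<alpha> i)" for i
  have ss: "s i * s i = 1" if "i \<in> I" for i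
    unfolding s_def by (simp add: eps_square mem that)
  \<comment> \<open>In this and the next three facts the exponents of -1 are 1 + 2*3 = 7, (3 + 9)/2
    = 6, (2 + 4)/2 = 3 and 0 + 3*3 = 9; their parity gives the sign.\<close>
  have eps_\<alpha>h: "\<epsilon> (\<alpha> i) h = - s i" if "i \<in> I" for i
    using eps_swap[of h "\<alpha> i" 1 2 3] that by (simp add: s_def mem inner_values)
  have eps_\<alpha>\<alpha>: "\<epsilon> (\<alpha> i) (\<alpha> i) = 1" if "i \<in> I" for i
    using eps_self[of "\<alpha> i" 3] that by (simp add: mem inner_values)
  have eps_hh: "\<epsilon> h h = -1"
    using eps_self[of h 2] by (simp add: mem inner_values)
  have eps_anti: "\<epsilon> (\<alpha> j) (\<alpha> i) = - \<epsilon> (\<alpha> i) (\<alpha> j)" if "i \<in> I" "j \<in> I" "i \<noteq> j" for i j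
    using eps_swap[of "\<alpha> i" "\<alpha> j" 0 3 3] that by (simp add: mem inner_values)
  note eps = eps_diff_left eps_diff_right eps_minus_left eps_minus_right mem s_def[symmetric]
    eps_\<alpha>h eps_\<alpha>\<alpha> eps_hh

  \<comment> \<open>The seven states\<close>
  define J0 :: "6 state" where "J0 = heis_vec h (-1) vac"
  \<comment> \<open>The factor 1 gives both charged currents the shape that
    \<open>products_exp_sum_contract\<close> and \<open>transl_exp\<close> expect.\<close>
  define Jp where "Jp = 1 *\<^sub>C bstate {#} h"
  define Jm where "Jm = (-1) *\<^sub>C bstate {#} (- h)"
  define Gp where "Gp = exp_sum I (\<lambda>_. 1) \<alpha>"
  define Gm where "Gm = exp_sum I (\<lambda>i. - s i) (\<lambda>i. \<alpha> i - h)"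
  define Gbp where "Gbp = exp_sum I (\<lambda>i. - s i / 3) (\<lambda>i. h - \<alpha> i)"
  define Gbm where "Gbm = exp_sum I (\<lambda>_. 1 / 3) (\<lambda>i. - \<alpha> i)"
  note G_defs = Gp_def Gm_def Gbp_def Gbm_def
  have Jp_exp_sum: "Jp = exp_sum {0} (\<lambda>_. 1) (\<lambda>_. h)"
    and Jm_exp_sum: "Jm = exp_sum {0} (\<lambda>_. -1) (\<lambda>_. - h)"
    by (simp_all add: Jp_def Jm_def exp_sum_def)
  have Jp_bstate: "bstate {#} h = Jp" and Jm_bstate: "bstate {#} (- h) = - Jm"
    by (simp_all add: Jp_def Jm_def)
  note exp_sums = Jp_exp_sum Jm_exp_sum G_defs
  have exp_sum_eqI: "exp_sum I a u = exp_sum I b v"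
    if "\<And>i. i \<in> I \<Longrightarrow> a i = b i \<and> u i = v i" for a b :: "nat \<Rightarrow> complex" and u v :: "nat \<Rightarrow> real^6"
    using that by (auto simp: exp_sum_def intro!: sum.cong)
  have exp_sum_minus: "- exp_sum I a u = exp_sum I (\<lambda>i. - a i) u" for a and u :: "nat \<Rightarrow> real^6"
    by (simp add: exp_sum_def sum_negf)
  \<comment> \<open>For \<open>Jm\<close> the sign of the coefficient cancels that of the exponent
    -h.\<close>
  have transl_J: "transl \<epsilon> Jp = heis_vec h (-1) (bstate {#} h)"
    "transl \<epsilon> Jm = heis_vec h (-1) (bstate {#} (- h))"
    "transl \<epsilon> J0 = heis_vec h (-2) vac"
    unfolding Jp_def Jm_def J0_def transl_heis
    by (simp_all only: transl_exp mem) (simp_all add: heis_vec_minus)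

  \<comment> \<open>Virasoro and primary field relations\<close>
  have virasoro: "virasoro_element \<epsilon> 6 lattice_virasoro"
    using virasoro_lattice_virasoro by simp
  have primary_J: "primary \<epsilon> lattice_virasoro 1 Jp" "primary \<epsilon> lattice_virasoro 1 Jm"
    "primary \<epsilon> lattice_virasoro 1 J0"
    using primary_exp_sum[of "{0}" "\<lambda>_. h" 1 "\<lambda>_. 1"] primary_exp_sum[of "{0}" "\<lambda>_. - h" 1 "\<lambda>_. -1"]
    by (simp_all add: exp_sums J0_def primary_heis mem inner_values)
  have primary_G: "primary \<epsilon> lattice_virasoro (3/2) Gp" "primary \<epsilon> lattice_virasoro (3/2) Gm"
    "primary \<epsilon> lattice_virasoro (3/2) Gbp" "primary \<epsilon> lattice_virasoro (3/2) Gbm"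
    using primary_exp_sum[of I _ "3/2"] by (simp_all add: G_defs mem inner_values)

  \<comment> \<open>Products with the currents\<close>
  have J0_J: "products \<epsilon> J0 Jp [2 *\<^sub>C Jp]" "products \<epsilon> J0 Jm [(-2) *\<^sub>C Jm]"
    using products_charge_exp_sum[of "{0}" "\<lambda>_. h" h 2 "\<lambda>_. 1"]
      products_charge_exp_sum[of "{0}" "\<lambda>_. - h" h "-2" "\<lambda>_. -1"]
    by (simp_all add: exp_sums J0_def mem inner_values)
  have J0_J0: "products \<epsilon> J0 J0 [0, (6 / 3) *\<^sub>C vac]"
    using products_heis_heis[of h h] by (simp add: J0_def inner_values)
  \<comment> \<open>The constant is \<open>1 * (-1) * \<epsilon> h (- h) = 1\<close>: here the minus
    sign in \<open>Jm\<close> compensates \<open>\<epsilon> h h = -1\<close>.\<close>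
  have Jp_Jm: "products \<epsilon> Jp Jm [J0, (6 / 6) *\<^sub>C vac]"
    using products_exp_sum_minus2[of "{0}" "\<lambda>_. h" "\<lambda>_. - h" 0 "\<lambda>_. 1" "\<lambda>_. -1" 1]
    by (simp add: exp_sums J0_def inner_values eps vac_def)
  have J_J: "products \<epsilon> Jp Jp []" "products \<epsilon> Jm Jm []"
    unfolding exp_sums by (auto intro!: products_exp_sum_zero simp: inner_values)
  have J0_G: "products \<epsilon> J0 Gp [Gp]" "products \<epsilon> J0 Gm [- Gm]"
    "products \<epsilon> J0 Gbp [Gbp]" "products \<epsilon> J0 Gbm [- Gbm]"
    using products_charge_exp_sum[of I _ h 1] products_charge_exp_sum[of I _ h "-1"]
    by (simp_all add: G_defs J0_def mem inner_values)
  \<comment> \<open>In this and the next three products every inner product of exponents is -1, so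
    the exponents are just shifted by h or -h; the signs are settled by \<open>s i * s i = 1\<close>
    and \<open>\<epsilon> h h = -1\<close>.\<close>
  have Jp_Gm: "products \<epsilon> Jp Gm [Gp]"
    unfolding Jp_def Gm_def
    by (rule products_cong[OF products_exp_sum_contract])
      (auto simp: Gp_def inner_values eps ss intro!: exp_sum_eqI)
  have Jm_Gp: "products \<epsilon> Jm Gp [Gm]"
    unfolding Jm_def Gp_def
    by (rule products_cong[OF products_exp_sum_contract])
      (auto simp: Gm_def inner_values eps ss intro!: exp_sum_eqI)
  have Jp_Gbm: "products \<epsilon> Jp Gbm [- Gbp]"
    unfolding Jp_def Gbm_def
    by (rule products_cong[OF products_exp_sum_contract])
      (auto simp: Gbp_def exp_sum_minus inner_values eps ss intro!: exp_sum_eqI)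
  have Jm_Gbp: "products \<epsilon> Jm Gbp [- Gbm]"
    unfolding Jm_def Gbp_def
    by (rule products_cong[OF products_exp_sum_contract])
      (auto simp: Gbm_def exp_sum_minus inner_values eps ss intro!: exp_sum_eqI)
  \<comment> \<open>All inner products of exponents are 1 here.\<close>
  have J_G_zero: "products \<epsilon> Jp Gp []" "products \<epsilon> Jm Gm []" "products \<epsilon> Jp Gbp []"
    "products \<epsilon> Jm Gbm []"
    unfolding exp_sums by (auto intro!: products_exp_sum_zero simp: inner_values)

  \<comment> \<open>Products of the weight 3/2 states\<close>
  have Gp_Gbp: "products \<epsilon> Gp Gbp [transl \<epsilon> Jp, 2 *\<^sub>C Jp]"
    unfolding Gp_def Gbp_def
    \<comment> \<open>The constant is \<open>(- s i / 3) * \<epsilon> (\<alpha> i) h * \<epsilon>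
      (\<alpha> i) (\<alpha> i)\<close> with middle factor \<open>- s i\<close>. It meets the
      exponent sum 3h in the mode 0 and the six indices in the mode 1.\<close>
    by (rule products_cong[OF products_exp_sum_minus2[where \<gamma> = h and c = "1/3"]])
      (auto simp: inner_values eps ss transl_J Jp_bstate sum_\<alpha> heis_vec_scaleR)
  have sum_\<alpha>h: "(\<Sum>i\<in>I. \<alpha> i - h) = (-3) *\<^sub>R h"
    by (simp add: sum_subtractf sum_\<alpha> sum_constant_scaleR scaleR_left_diff_distrib[symmetric]
        del: sum_constant)
  \<comment> \<open>Here the constant is \<open>(- s i) * (1/3) * s i = -1/3\<close>, and the
    exponents add up to 3h - 6h.\<close>
  have Gm_Gbm: "products \<epsilon> Gm Gbm [transl \<epsilon> Jm, 2 *\<^sub>C Jm]"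
    unfolding Gm_def Gbm_def
    by (rule products_cong[OF products_exp_sum_minus2[where \<gamma> = "- h" and c = "-1/3"]])
      (auto simp: inner_values eps ss transl_J Jm_bstate sum_\<alpha>h heis_vec_scaleR heis_vec_minus heis_vec_linear)
  have span_\<alpha>: "span (\<alpha> ` I) = UNIV"
    using basis(2) by (simp only: I_def)
  have frame_\<alpha>: "(\<Sum>i\<in>I. \<alpha> i $ a * \<alpha> i $ b) = (if a = b then 3 else 0)" for a b
    by (rule orthogonal_basis_frame[OF _ span_\<alpha>]) (simp_all add: \<alpha>\<alpha>)
  \<comment> \<open>The mixed terms contribute -3 \<open>h $ a * h $ b\<close> twice and the six
    squares +6 times the same product. Geometrically, \<alpha>_i - h is the image of \<alpha>_i
    under the reflection in h.\<close>
  have frame_\<alpha>h: "(\<Sum>i\<in>I. (\<alpha> i - h) $ a * (\<alpha> i - h) $ b) = (if a = b then 3 else 0)" for a b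
  proof -
    have "(\<Sum>i\<in>I. \<alpha> i $ a) = 3 * h $ a" for a
      using arg_cong[OF sum_\<alpha>, of "\<lambda>x. x $ a"] by simp
    then have "(\<Sum>i\<in>I. (\<alpha> i - h) $ a * (\<alpha> i - h) $ b) = (\<Sum>i\<in>I. \<alpha> i $ a * \<alpha> i $ b)"
      by (simp add: algebra_simps sum.distrib sum_subtractf sum_distrib_left[symmetric])
    then show ?thesis by (simp add: frame_\<alpha>)
  qed
  have Gp_Gbm: "products \<epsilon> Gp Gbm [lattice_virasoro + (1/2) *\<^sub>C transl \<epsilon> J0, J0, (6 / 3) *\<^sub>C vac]"
    unfolding Gp_def Gbm_def
    \<comment> \<open>The frame constant 3 makes the quadratic part \<open>(1/6) * 6\<close> times
      the Virasoro vector, and the exponent sum 3h gives the coefficient 1/2 of the derivative of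
      \<open>J0\<close>.\<close>
    by (rule products_cong[OF products_exp_sum_minus3[where c = "1/3"]])
      (auto simp: inner_values eps lattice_virasoro_from_frame[OF frame_\<alpha>] transl_heis J0_def sum_\<alpha>
        heis_vec_scaleR heis_vec_minus scale.scale_right_distrib scale.scale_right_diff_distrib)
  \<comment> \<open>The constant is again 1/3, as the four cocycle factors multiply to 1; only the
    exponent sum changes sign.\<close>
  have Gm_Gbp: "products \<epsilon> Gm Gbp [lattice_virasoro - (1/2) *\<^sub>C transl \<epsilon> J0, - J0, (6 / 3) *\<^sub>C vac]"
    unfolding Gm_def Gbp_def
    by (rule products_cong[OF products_exp_sum_minus3[where c = "1/3"]])
      (auto simp: inner_values eps ss lattice_virasoro_from_frame[OF frame_\<alpha>h] transl_heis J0_def sum_\<alpha>h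
        heis_vec_scaleR heis_vec_minus scale.scale_right_distrib scale.scale_right_diff_distrib)
  have G_G: "products \<epsilon> Gp Gp []" "products \<epsilon> Gm Gm []" "products \<epsilon> Gbp Gbp []" "products \<epsilon> Gbm Gbm []"
    unfolding G_defs by (auto intro!: products_exp_sum_zero simp: inner_values)
  \<comment> \<open>Inner products are 2 on the diagonal and -1 off it. Up to a constant the
    coefficient is \<open>s i * s j * \<epsilon> (\<alpha> i) (\<alpha> j)\<close>, which
    \<open>eps_anti\<close> makes antisymmetric.\<close>
  have Gp_Gm: "products \<epsilon> Gp Gm []" "products \<epsilon> Gm Gp []" "products \<epsilon> Gbp Gbm []"
    "products \<epsilon> Gbm Gbp []"
    unfolding G_defs
    by (rule products_exp_sum_antisym, (auto simp: inner_values eps algebra_simps)[3],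
        frule (2) eps_anti, simp add: inner_values eps)+

  \<comment> \<open>Currents and Virasoro vector inside the generated subalgebra\<close>
  let ?A = "generated_subalgebra \<epsilon> {Gp, Gm, Gbp, Gbm}"
  have gens: "Gp \<in> ?A" "Gm \<in> ?A" "Gbp \<in> ?A" "Gbm \<in> ?A"
    by (auto intro: generated_subalgebra.gen)
  have "2 *\<^sub>C Jp \<in> ?A" "2 *\<^sub>C Jm \<in> ?A"
    using generated_subalgebra.product[OF gens(1,3), of 1] generated_subalgebra.product[OF gens(2,4), of 1]
      products_nth[OF Gp_Gbp, of 1] products_nth[OF Gm_Gbm, of 1] by simp_all
  then have JA: "Jp \<in> ?A" "Jm \<in> ?A"
    by (simp_all only: generated_subalgebra_halve[of Jp] generated_subalgebra_halve[of Jm])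
  have J0A: "J0 \<in> ?A"
    using generated_subalgebra.product[OF gens(1,4), of 1] products_nth[OF Gp_Gbm, of 1] by simp
  have "lattice_virasoro + (1/2) *\<^sub>C transl \<epsilon> J0 \<in> ?A"
    using generated_subalgebra.product[OF gens(1,4), of 0] products_nth[OF Gp_Gbm, of 0] by simp
  \<comment> \<open>The derivative is the mode -2 of \<open>J0\<close> on the vacuum, so it lies in
    the subalgebra and can be subtracted.\<close>
  moreover have "(-1/2) *\<^sub>C transl \<epsilon> J0 \<in> ?A"
    unfolding transl_def by (intro generated_subalgebra.scale generated_subalgebra.product J0A
        generated_subalgebra.vac)
  ultimately have "(lattice_virasoro + (1/2) *\<^sub>C transl \<epsilon> J0) + (-1/2) *\<^sub>C transl \<epsilon> J0 \<in> ?A"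
    by (rule generated_subalgebra.add)
  then have \<omega>A: "lattice_virasoro \<in> ?A" by simp

  \<comment> \<open>Weights and assembly\<close>
  have subset: "?A \<subseteq> lattice_sva L"
    by (rule generated_subalgebra_subset[OF add_mem zero_mem]) (simp_all add: G_defs exp_sum_mem mem)
  have weight_G: "has_weight Gp (3/2)" "has_weight Gm (3/2)" "has_weight Gbp (3/2)" "has_weight Gbm (3/2)"
    unfolding G_defs by (rule has_weight_exp_sum; simp add: inner_values)+
  have weight_J: "has_weight Jp 1" "has_weight Jm 1" "has_weight J0 1"
    unfolding Jp_exp_sum Jm_exp_sum J0_def
    by (simp_all add: has_weight_exp_sum has_weight_heis_vac inner_values)
  have relations: "N4_relations \<epsilon> 6 lattice_virasoro Gp Gm Gbp Gbm Jp Jm J0"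
    unfolding N4_relations_def ball_simps(5,7)
    by (intro conjI TrueI virasoro primary_J primary_G J0_J J0_J0 Jp_Jm J_J J0_G Jp_Gm Jm_Gp Jp_Gbm
        Jm_Gbp J_G_zero Gp_Gbp Gm_Gbm Gp_Gbm Gm_Gbp G_G Gp_Gm)
  have "N4_subalgebra L \<epsilon> 6 lattice_virasoro ?A"
    unfolding N4_subalgebra_def
    by (intro conjI subset, rule exI[of _ Gp], rule exI[of _ Gm], rule exI[of _ Gbp],
        rule exI[of _ Gbm], rule exI[of _ Jp], rule exI[of _ Jm], rule exI[of _ J0])
      (simp add: weight_G weight_J JA J0A \<omega>A relations)
  then show ?thesis ..
qed

end
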